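(* Consider (effective) Quantum General Relativity coupled to the Standard Model. The interaction Lagrange densities between gravitons and matter particles (the densities (S), (F), (Y), (G), (B), (H), (E) listed in the context) are of the following $10$ types, i.e. each of them is a finite sum of terms of the forms $$\begin{aligned} &{}_1T\,dV_g,\quad g^{\mu\nu}\,{}_2T_{\mu\nu}\,dV_g,\quad g^{\mu\nu}g^{\rho\sigma}\,{}_3T_{\mu\nu\rho\sigma}\,dV_g,\quad g^{\mu\nu}\Gamma_{\mu\nu}{}^\tau\,{}_4T_\tau\,dV_g,\\ &g^{\mu\nu}g^{\rho\sigma}\Gamma_{\mu\nu}{}^\tau\,{}_5T_{\rho\sigma\tau}\,dV_g,\quad g^{\mu\nu}g^{\rho\sigma}\Gamma_{\mu\nu}{}^\kappa\Gamma_{\rho\sigma}{}^\lambda\,{}_6T_{\kappa\lambda}\,dV_g,\quad e_0^o\,{}_7T_o\,dV_g,\\ &e_0^oe^{\rho r}\,{}_8T_{o\rho r}\,dV_g,\quad e_0^oe^{\rho r}e^{\sigma s}(\partial_\rho e_\sigma^t)\,{}_9T_{orst}\,dV_g,\quad e_0^oe^{\rho r}e^{\sigma s}e_\tau^t\Gamma_{\rho\sigma}{}^\tau\,{}_{10}T_{orst}\,dV_g, \end{aligned}$$ where the arrays ${}_kT$ are graviton-free matter contributions: they are built from the matter fields, their coordinate partial derivatives and constants, and do not depend on the metric $g$, the vielbein $e$ or $\Gamma$.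
   Context: Spacetime is $\mathbb{R}^4$ with background metric $\eta=\mathrm{diag}(1,-1,-1,-1)$ and Lorentzian metric $g=\eta+\varkappa h$; $dV_g=\sqrt{-\det g}\,d^4x$; repeated indices are summed. $\Gamma_{\mu\nu}{}^\rho$ are the Levi-Civita Christoffel symbols of $g$, $\nabla$ its covariant derivative ($\nabla_\mu A_\nu=\partial_\mu A_\nu-\Gamma_{\mu\nu}{}^\tau A_\tau$). $e_\mu^m$ is a vielbein ($g_{\mu\nu}=\eta_{mn}e^m_\mu e^n_\nu$) with inverse $e^\mu_m$, and $e^{\mu m}=\eta^{mn}e^\mu_n$. $\gamma_m$ are constant Dirac matrices with $\{\gamma_m,\gamma_n\}=2\eta_{mn}$, $\sigma_{st}=\frac i2[\gamma_s,\gamma_t]$; the spin connection form is $\varpi_\mu=-\frac i4\,\omega_\mu{}^{st}\sigma_{st}$ with $\omega_\mu{}^{st}=e_\nu^s(\partial_\mu e^{\nu t}+\Gamma_{\mu\lambda}{}^\nu e^{\lambda t})$. For a spinor (or vector of spinors) $\psi$: $\overline\psi_o=(\gamma_o\psi)^\dagger$ and $\overline\psi=e_0^o\,\overline\psi_o$, where $e_0^o$ is the vielbein with curved index $0$. $A^a_\mu$ are gauge fields, $\mathfrak b_a$ constant matrices representing a basis of the gauge Lie algebra, $f^{abc}$ structure constants; other parameters ($\mathrm g,\alpha,m,\xi$) are constants; index sets are finite. Gauge indices in sums are contracted. The Lagrange densities are: (S) Scalars: $\big(\frac12g^{\mu\nu}\partial_\mu\phi\,\partial_\nu\phi+\sum_i\frac{\alpha_i}{i!}\phi^i\big)dV_g$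 for a real scalar field $\phi$, and $\big(g^{\mu\nu}(\nabla^G_\mu\Phi)^\dagger(\nabla^G_\nu\Phi)+\sum_i\frac{\alpha_i}{i!}(\Phi^\dagger\Phi)^i\big)dV_g$ for a vector $\Phi$ of complex scalar fields, $\nabla^G_\mu=\partial_\mu+i\mathrm gA^a_\mu\mathfrak b_a$. (F) Spinors: $\overline\psi\big(i\,e^{\mu m}\gamma_m(\partial_\mu+\varpi_\mu)-m_\psi\big)\psi\,dV_g$ for a spinor field $\psi$, and $\overline\Psi\big(i\,e^{\mu m}\gamma_m(\partial_\mu+\varpi_\mu+i\mathrm gA^a_\mu\mathfrak b_a)-\boldsymbol m_\Psi\big)\Psi\,dV_g$ for a vector of spinor fields, $\boldsymbol m_\Psi$ a constant diagonal matrix. (Y) Yukawa: $-\sum\alpha_{\{\phi,\overline\psi,\psi\}}\,\phi\,e_0^o\overline\psi_o\psi\,dV_g$. (G) Gauge bosons: $\frac{1}{4\mathrm g^2}\delta_{ab}g^{\mu\nu}g^{\rho\sigma}F^a_{\mu\rho}F^b_{\nu\sigma}\,dV_g$, where $F^a_{\mu\nu}$ is $i\mathrm g$ times the Yang–Mills field strength formed from partial derivatives $\partial_\mu A^a_\nu-\partial_\nu A^a_\mu$ and a term quadratic in $A$; with Lorenz gauge fixing $\frac{1}{2\xi}\delta_{ab}g^{\mu\nu}g^{\rho\sigma}(\nabla_\mu A^a_\nu)(\nabla_\rho A^b_\sigma)\,dV_g$. (B) Gauge fixing in the spontaneously broken case: $\big(\frac{1}{2\xi_Z}g^{\mu\nu}g^{\rho\sigma}(\nabla_\mu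 Z_\nu)(\nabla_\rho Z_\sigma)+m_Z\phi_Zg^{\mu\nu}\nabla_\mu Z_\nu+\frac{\xi_Z}{2}m_Z^2\phi_Z^2\big)dV_g$ and $\big(\frac1{\xi_W}g^{\mu\nu}g^{\rho\sigma}(\nabla_\mu W^-_\nu)(\nabla_\rho W^+_\sigma)+\xi_Wm_W^2\phi_{W^-}\phi_{W^+}+i\,m_Wg^{\mu\nu}(\phi_{W^+}\nabla_\mu W^-_\nu-\phi_{W^-}\nabla_\mu W^+_\nu)\big)dV_g$, with Goldstone bosons $\phi_Z,\phi_{W^\pm}$. (H) Gauge ghosts: $\big(g^{\mu\nu}\overline c_a\nabla_\mu(\partial_\nu c^a)+i\mathrm g\,g^{\mu\nu}f^a{}_{bc}\,\overline c_a\nabla_\mu(A^b_\nu c^c)\big)dV_g$ with ghosts $c^a$ and antighosts $\overline c_a$ (odd scalar fields). (E) Electroweak ghosts with Higgs and Goldstone bosons: $\sum(\xi_{s_2}m_{s_2})\phi^{s_1}\overline c^{s_2}c^{s_3}\,dV_g$. *)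

theory Defs
  imports "HOL-Analysis.Analysis"
begin

section \<open>Values of matter fields\<close>

text \<open>
  Matter fields take values in a normed complex \<open>*\<close>-algebra that is graded-commutative, so that
  bosonic (even) and anticommuting (odd) fields are treated alike.  The map \<open>parity\<close> is the grading
  involution: it is \<open>1\<close> on even and \<open>-1\<close> on odd elements.  Both the complex numbers and the
  Grassmann algebras over finitely many generators are instances (see below).
\<close>

class star_superalgebra = real_normed_algebra_1 +
  fixes scaleC :: "complex \<Rightarrow> 'a \<Rightarrow> 'a" (infixr "*\<^sub>C" 75)
    and star :: "'a \<Rightarrow> 'a"
    and parity :: "'a \<Rightarrow> 'a"
  assumes scaleC_add_right: "a *\<^sub>C (x + y) = a *\<^sub>C x + a *\<^sub>C y"
    and scaleC_add_left: "(a + b) *\<^sub>C x = a *\<^sub>C x + b *\<^sub>C x"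
    and scaleC_scaleC: "a *\<^sub>C b *\<^sub>C x = (a * b) *\<^sub>C x"
    and scaleR_scaleC: "r *\<^sub>R x = complex_of_real r *\<^sub>C x"
    and mult_scaleC_left: "(a *\<^sub>C x) * y = a *\<^sub>C (x * y)"
    and mult_scaleC_right: "x * (a *\<^sub>C y) = a *\<^sub>C (x * y)"
    and norm_scaleC: "norm (a *\<^sub>C x) = cmod a * norm x"
    and star_add: "star (x + y) = star x + star y"
    and star_scaleC: "star (a *\<^sub>C x) = cnj a *\<^sub>C star x"
    and star_mult: "star (x * y) = star y * star x"
    and star_star: "star (star x) = x"
    and norm_star: "norm (star x) = norm x"
    and parity_add: "parity (x + y) = parity x + parity y"
    and parity_scaleC: "parity (a *\<^sub>C x) = a *\<^sub>C parity x"
    and parity_mult: "parity (x * y) = parity x * parity y"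
    and parity_parity: "parity (parity x) = x"
    and parity_star: "parity (star x) = star (parity x)"
    and norm_parity: "norm (parity x) = norm x"
    and even_commute: "parity x = x \<Longrightarrow> x * y = y * x"
    and odd_anticommute: "parity x = - x \<Longrightarrow> parity y = - y \<Longrightarrow> x * y = - (y * x)"

instantiation complex :: star_superalgebra
begin

definition scaleC_complex :: "complex \<Rightarrow> complex \<Rightarrow> complex" where "scaleC_complex = (*)"
definition star_complex :: "complex \<Rightarrow> complex" where "star_complex = cnj"
definition parity_complex :: "complex \<Rightarrow> complex" where "parity_complex = id"

instance
  by standard
    (simp_all add: scaleC_complex_def star_complex_def parity_complex_def algebra_simps norm_mult
      scaleR_conv_of_real)

end

section \<open>Spacetime, metric and vielbein\<close>

type_synonym spacetime = "real ^ 4"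
type_synonym matrix_field = "spacetime \<Rightarrow> real ^ 4 ^ 4"

definition pd :: "4 \<Rightarrow> (spacetime \<Rightarrow> 'b::real_normed_vector) \<Rightarrow> spacetime \<Rightarrow> 'b" where
  "pd \<mu> f x = frechet_derivative f (at x) (axis \<mu> 1)"

text \<open>All iterated partial derivatives exist and are differentiable, i.e. the function is \<open>C\<close>-infinity.\<close>

definition smooth :: "(spacetime \<Rightarrow> 'b::real_normed_vector) \<Rightarrow> bool" where
  "smooth f \<longleftrightarrow> (\<forall>\<mu>s x. foldr pd \<mu>s f differentiable at x)"

text \<open>The matrix \<open>diag(1,-1,-1,-1)\<close> is its own inverse, so it also serves as \<open>\<eta>\<close> with upper indices.\<close>

definition eta :: "4 \<Rightarrow> 4 \<Rightarrow> real" where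
  "eta m n = (if m = n then if m = 0 then 1 else - 1 else 0)"

definition metric :: "real \<Rightarrow> matrix_field \<Rightarrow> matrix_field" where
  "metric \<kappa> h x = (\<chi> \<mu> \<nu>. eta \<mu> \<nu> + \<kappa> * h x $ \<mu> $ \<nu>)"

text \<open>Symmetric of signature \<open>(+,-,-,-)\<close>: negative definite on the complement of a timelike vector.\<close>

definition lorentzian :: "real ^ 4 ^ 4 \<Rightarrow> bool" where
  "lorentzian G \<longleftrightarrow> transpose G = G \<and>
    (\<exists>v. v \<bullet> (G *v v) > 0 \<and> (\<forall>w. w \<noteq> 0 \<and> v \<bullet> (G *v w) = 0 \<longrightarrow> w \<bullet> (G *v w) < 0))"

text \<open>The vielbein component with flat index \<open>m\<close> and curved index \<open>\<mu>\<close> is \<open>e x $ m $ \<mu>\<close>.\<close>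

definition graviton_background :: "real \<Rightarrow> matrix_field \<Rightarrow> matrix_field \<Rightarrow> bool" where
  "graviton_background \<kappa> h e \<longleftrightarrow> smooth h \<and> smooth e \<and>
    (\<forall>x. lorentzian (metric \<kappa> h x)) \<and>
    (\<forall>x \<mu> \<nu>. metric \<kappa> h x $ \<mu> $ \<nu> = (\<Sum>(m, n)\<in>UNIV. eta m n * e x $ m $ \<mu> * e x $ n $ \<nu>))"

definition ginv :: "matrix_field \<Rightarrow> spacetime \<Rightarrow> 4 \<Rightarrow> 4 \<Rightarrow> real" where
  "ginv g x \<mu> \<nu> = matrix_inv (g x) $ \<mu> $ \<nu>"

definition vol :: "matrix_field \<Rightarrow> spacetime \<Rightarrow> real" where
  "vol g x = sqrt (- det (g x))"

definition christoffel :: "matrix_field \<Rightarrow> spacetime \<Rightarrow> 4 \<Rightarrow> 4 \<Rightarrow> 4 \<Rightarrow> real" where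
  "christoffel g x \<mu> \<nu> \<rho> = 1 / 2 * (\<Sum>\<sigma>\<in>UNIV. ginv g x \<rho> \<sigma> *
    (pd \<mu> (\<lambda>y. g y $ \<sigma> $ \<nu>) x + pd \<nu> (\<lambda>y. g y $ \<mu> $ \<sigma>) x - pd \<sigma> (\<lambda>y. g y $ \<mu> $ \<nu>) x))"

definition cov ::
  "matrix_field \<Rightarrow> 4 \<Rightarrow> (4 \<Rightarrow> spacetime \<Rightarrow> 'z::real_normed_vector) \<Rightarrow> 4 \<Rightarrow> spacetime \<Rightarrow> 'z" where
  "cov g \<mu> V \<nu> x = pd \<mu> (V \<nu>) x - (\<Sum>\<tau>\<in>UNIV. christoffel g x \<mu> \<nu> \<tau> *\<^sub>R V \<tau> x)"

text \<open>Inverse vielbein, with the flat index as lower index (\<open>vinv e x \<mu> m\<close>) and raised by \<open>\<eta>\<close>.\<close>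

definition vinv :: "matrix_field \<Rightarrow> spacetime \<Rightarrow> 4 \<Rightarrow> 4 \<Rightarrow> real" where
  "vinv e x \<mu> m = matrix_inv (e x) $ \<mu> $ m"

definition vup :: "matrix_field \<Rightarrow> spacetime \<Rightarrow> 4 \<Rightarrow> 4 \<Rightarrow> real" where
  "vup e x \<mu> m = (\<Sum>n\<in>UNIV. eta m n * vinv e x \<mu> n)"

definition omega :: "matrix_field \<Rightarrow> matrix_field \<Rightarrow> spacetime \<Rightarrow> 4 \<Rightarrow> 4 \<Rightarrow> 4 \<Rightarrow> real" where
  "omega g e x \<mu> s t = (\<Sum>\<nu>\<in>UNIV. e x $ s $ \<nu> *
    (pd \<mu> (\<lambda>y. vup e y \<nu> t) x + (\<Sum>\<rho>\<in>UNIV. christoffel g x \<mu> \<rho> \<nu> * vup e x \<rho> t)))"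

definition clifford :: "(4 \<Rightarrow> complex ^ 4 ^ 4) \<Rightarrow> bool" where
  "clifford \<gamma> \<longleftrightarrow>
    (\<forall>m n. \<gamma> m ** \<gamma> n + \<gamma> n ** \<gamma> m = mat (complex_of_real (2 * eta m n)))"

definition sigma :: "(4 \<Rightarrow> complex ^ 4 ^ 4) \<Rightarrow> 4 \<Rightarrow> 4 \<Rightarrow> complex ^ 4 ^ 4" where
  "sigma \<gamma> s t = (\<chi> \<alpha> \<beta>. \<i> / 2 * (\<gamma> s ** \<gamma> t - \<gamma> t ** \<gamma> s) $ \<alpha> $ \<beta>)"

definition spin_connection ::
  "(4 \<Rightarrow> complex ^ 4 ^ 4) \<Rightarrow> matrix_field \<Rightarrow> matrix_field \<Rightarrow> spacetime \<Rightarrow> 4 \<Rightarrow> complex ^ 4 ^ 4" where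
  "spin_connection \<gamma> g e x \<mu> = (\<chi> \<alpha> \<beta>. - (\<i> / 4) *
    (\<Sum>(s, t)\<in>UNIV. complex_of_real (omega g e x \<mu> s t) * sigma \<gamma> s t $ \<alpha> $ \<beta>))"

section \<open>Matter\<close>

text \<open>
  A matter configuration assigns a function on spacetime to every component field.  Composite
  objects (vectors of scalar or spinor fields, the gauge fields \<open>A\<^sup>a\<close>) are families of labels:
  a vector of scalar fields is given by \<open>\<Phi> :: 'k \<Rightarrow> 's\<close>, its components are \<open>Scalar (\<Phi> k)\<close>.
  The second argument of \<open>Spinor\<close> is the spinor index, that of \<open>Vector\<close> the covariant
  spacetime index.
\<close>

datatype ('s, 'f, 'v, 'c) label =
  Scalar 's | Spinor 'f 4 | Vector 'v 4 | Ghost 'c | Antighost 'c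

type_synonym ('s, 'f, 'v, 'c, 'z) matter = "('s, 'f, 'v, 'c) label \<Rightarrow> spacetime \<Rightarrow> 'z"

text \<open>
  \<open>R\<close> is the set of (labels of) real scalar fields.  No parity is imposed on spinors, so that both
  commuting and anticommuting spinor fields are covered.
\<close>

definition matter_configuration ::
  "'s set \<Rightarrow> ('s, 'f, 'v, 'c, 'z::star_superalgebra) matter \<Rightarrow> bool" where
  "matter_configuration R F \<longleftrightarrow> (\<forall>l. smooth (F l)) \<and>
    (\<forall>s x. parity (F (Scalar s) x) = F (Scalar s) x) \<and>
    (\<forall>s\<in>R. \<forall>x. star (F (Scalar s) x) = F (Scalar s) x) \<and>
    (\<forall>v \<mu> x. parity (F (Vector v \<mu>) x) = F (Vector v \<mu>) x) \<and>
    (\<forall>c x. parity (F (Ghost c) x) = - F (Ghost c) x) \<and>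
    (\<forall>c x. parity (F (Antighost c) x) = - F (Antighost c) x)"

text \<open>Local functionals built from constants, fields, their adjoints and their partial derivatives.\<close>

inductive matter_built ::
  "(('s, 'f, 'v, 'c, 'z::star_superalgebra) matter \<Rightarrow> spacetime \<Rightarrow> 'z) \<Rightarrow> bool" where
  const: "matter_built (\<lambda>F x. a *\<^sub>C 1)"
| field: "matter_built (\<lambda>F x. foldr pd \<mu>s (F l) x)"
| adjoint: "matter_built T \<Longrightarrow> matter_built (\<lambda>F x. star (T F x))"
| add: "matter_built S \<Longrightarrow> matter_built T \<Longrightarrow> matter_built (\<lambda>F x. S F x + T F x)"
| mult: "matter_built S \<Longrightarrow> matter_built T \<Longrightarrow> matter_built (\<lambda>F x. S F x * T F x)"

section \<open>The ten types of interaction terms\<close>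

text \<open>
  A density depends on the metric, the vielbein and the matter configuration; its value is the
  coefficient of \<open>d\<^sup>4x\<close>, so \<open>dV\<^sub>g\<close> is rendered by the factor \<open>vol g\<close>.
\<close>

type_synonym ('s, 'f, 'v, 'c, 'z) density =
  "matrix_field \<Rightarrow> matrix_field \<Rightarrow> ('s, 'f, 'v, 'c, 'z) matter \<Rightarrow> spacetime \<Rightarrow> 'z"

inductive interaction_term :: "('s, 'f, 'v, 'c, 'z::star_superalgebra) density \<Rightarrow> bool" where
  type1: "matter_built T \<Longrightarrow>
    interaction_term (\<lambda>g e F x. vol g x *\<^sub>R T F x)"
| type2: "(\<And>\<mu> \<nu>. matter_built (T \<mu> \<nu>)) \<Longrightarrow>
    interaction_term (\<lambda>g e F x. vol g x *\<^sub>R (\<Sum>(\<mu>, \<nu>)\<in>UNIV. ginv g x \<mu> \<nu> *\<^sub>R T \<mu> \<nu> F x))"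
| type3: "(\<And>\<mu> \<nu> \<rho> \<sigma>. matter_built (T \<mu> \<nu> \<rho> \<sigma>)) \<Longrightarrow>
    interaction_term (\<lambda>g e F x. vol g x *\<^sub>R (\<Sum>(\<mu>, \<nu>, \<rho>, \<sigma>)\<in>UNIV.
      (ginv g x \<mu> \<nu> * ginv g x \<rho> \<sigma>) *\<^sub>R T \<mu> \<nu> \<rho> \<sigma> F x))"
| type4: "(\<And>\<tau>. matter_built (T \<tau>)) \<Longrightarrow>
    interaction_term (\<lambda>g e F x. vol g x *\<^sub>R (\<Sum>(\<mu>, \<nu>, \<tau>)\<in>UNIV.
      (ginv g x \<mu> \<nu> * christoffel g x \<mu> \<nu> \<tau>) *\<^sub>R T \<tau> F x))"
| type5: "(\<And>\<rho> \<sigma> \<tau>. matter_built (T \<rho> \<sigma> \<tau>)) \<Longrightarrow>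
    interaction_term (\<lambda>g e F x. vol g x *\<^sub>R (\<Sum>(\<mu>, \<nu>, \<rho>, \<sigma>, \<tau>)\<in>UNIV.
      (ginv g x \<mu> \<nu> * ginv g x \<rho> \<sigma> * christoffel g x \<mu> \<nu> \<tau>) *\<^sub>R T \<rho> \<sigma> \<tau> F x))"
| type6: "(\<And>\<kappa> \<tau>. matter_built (T \<kappa> \<tau>)) \<Longrightarrow>
    interaction_term (\<lambda>g e F x. vol g x *\<^sub>R (\<Sum>(\<mu>, \<nu>, \<rho>, \<sigma>, \<kappa>, \<tau>)\<in>UNIV.
      (ginv g x \<mu> \<nu> * ginv g x \<rho> \<sigma> * christoffel g x \<mu> \<nu> \<kappa> * christoffel g x \<rho> \<sigma> \<tau>) *\<^sub>R
        T \<kappa> \<tau> F x))"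
| type7: "(\<And>b. matter_built (T b)) \<Longrightarrow>
    interaction_term (\<lambda>g e F x. vol g x *\<^sub>R (\<Sum>b\<in>UNIV. (e x $ b $ 0) *\<^sub>R T b F x))"
| type8: "(\<And>b \<rho> r. matter_built (T b \<rho> r)) \<Longrightarrow>
    interaction_term (\<lambda>g e F x. vol g x *\<^sub>R (\<Sum>(b, \<rho>, r)\<in>UNIV.
      (e x $ b $ 0 * vup e x \<rho> r) *\<^sub>R T b \<rho> r F x))"
| type9: "(\<And>b r s t. matter_built (T b r s t)) \<Longrightarrow>
    interaction_term (\<lambda>g e F x. vol g x *\<^sub>R (\<Sum>(b, \<rho>, r, \<sigma>, s, t)\<in>UNIV.
      (e x $ b $ 0 * vup e x \<rho> r * vup e x \<sigma> s * pd \<rho> (\<lambda>y. e y $ t $ \<sigma>) x) *\<^sub>R T b r s t F x))"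
| type10: "(\<And>b r s t. matter_built (T b r s t)) \<Longrightarrow>
    interaction_term (\<lambda>g e F x. vol g x *\<^sub>R (\<Sum>(b, \<rho>, r, \<sigma>, s, \<tau>, t)\<in>UNIV.
      (e x $ b $ 0 * vup e x \<rho> r * vup e x \<sigma> s * e x $ t $ \<tau> * christoffel g x \<rho> \<sigma> \<tau>) *\<^sub>R
        T b r s t F x))"

text \<open>The terms, hence the matter contributions in them, are chosen independently of the gravitational field.\<close>

definition finite_sum_of_interaction_terms ::
  "'s set \<Rightarrow> ('s, 'f, 'v, 'c, 'z::star_superalgebra) density \<Rightarrow> bool" where
  "finite_sum_of_interaction_terms R L \<longleftrightarrow> (\<exists>Ls. (\<forall>l\<in>set Ls. interaction_term l) \<and>
    (\<forall>\<kappa> h e F x. graviton_background \<kappa> h e \<longrightarrow> matter_configuration R F \<longrightarrow>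
      L (metric \<kappa> h) e F x = (\<Sum>l\<leftarrow>Ls. l (metric \<kappa> h) e F x)))"

section \<open>Gauge structure\<close>

text \<open>
  \<open>f a b c\<close> is the structure constant with upper index \<open>a\<close> and lower indices \<open>b\<close>, \<open>c\<close>.
  It may be complex: for Hermitian generators the customary factor \<open>\<i>\<close> is part of \<open>f\<close>.
\<close>

definition structure_constants :: "('a::finite \<Rightarrow> 'a \<Rightarrow> 'a \<Rightarrow> complex) \<Rightarrow> bool" where
  "structure_constants f \<longleftrightarrow> (\<forall>a b c. f a b c = - f a c b) \<and>
    (\<forall>a b c d. (\<Sum>k\<in>UNIV. f a b k * f k c d + f a c k * f k d b + f a d k * f k b c) = 0)"

definition represents ::
  "('a::finite \<Rightarrow> 'a \<Rightarrow> 'a \<Rightarrow> complex) \<Rightarrow> ('a \<Rightarrow> complex ^ 'k ^ 'k::finite) \<Rightarrow> bool" where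
  "represents f \<bb> \<longleftrightarrow> (\<forall>b c i j.
    (\<bb> b ** \<bb> c - \<bb> c ** \<bb> b) $ i $ j = (\<Sum>a\<in>UNIV. f a b c * \<bb> a $ i $ j))"

text \<open>
  The coefficient \<open>q\<close> of the quadratic term depends on sign and phase conventions;
  \<open>q = \<i> * gc\<close> is the one for which this is the curvature of \<open>\<partial> + \<i> gc A\<^sup>a b\<^sub>a\<close>.
\<close>

definition field_strength ::
  "real \<Rightarrow> complex \<Rightarrow> ('a::finite \<Rightarrow> 'a \<Rightarrow> 'a \<Rightarrow> complex) \<Rightarrow> ('a \<Rightarrow> 'v) \<Rightarrow>
    ('s, 'f, 'v, 'c, 'z::star_superalgebra) matter \<Rightarrow> 'a \<Rightarrow> 4 \<Rightarrow> 4 \<Rightarrow> spacetime \<Rightarrow> 'z" where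
  "field_strength gc q f A F a \<mu> \<nu> x = (\<i> * gc) *\<^sub>C
    (pd \<mu> (F (Vector (A a) \<nu>)) x - pd \<nu> (F (Vector (A a) \<mu>)) x +
      q *\<^sub>C (\<Sum>(b, c)\<in>UNIV. f a b c *\<^sub>C (F (Vector (A b) \<mu>) x * F (Vector (A c) \<nu>) x)))"

text \<open>Component \<open>k\<close> of \<open>\<i> gc A\<^sup>a\<^sub>\<mu> b\<^sub>a X\<close>.\<close>

definition gauge_action ::
  "real \<Rightarrow> ('a::finite \<Rightarrow> complex ^ 'k ^ 'k::finite) \<Rightarrow> ('a \<Rightarrow> 'v) \<Rightarrow>
    ('s, 'f, 'v, 'c, 'z::star_superalgebra) matter \<Rightarrow> 4 \<Rightarrow> ('k \<Rightarrow> 'z) \<Rightarrow> 'k \<Rightarrow> spacetime \<Rightarrow> 'z" where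
  "gauge_action gc \<bb> A F \<mu> X k x =
    (\<i> * gc) *\<^sub>C (\<Sum>(a, j)\<in>UNIV. F (Vector (A a) \<mu>) x * (\<bb> a $ k $ j *\<^sub>C X j))"

section \<open>The Lagrange densities\<close>

definition real_scalar_density ::
  "nat set \<Rightarrow> (nat \<Rightarrow> complex) \<Rightarrow> 's \<Rightarrow> ('s, 'f, 'v, 'c, 'z::star_superalgebra) density" where
  "real_scalar_density I \<alpha> s g e F x = (let \<phi> = F (Scalar s) in vol g x *\<^sub>R
    ((1 / 2) *\<^sub>R (\<Sum>(\<mu>, \<nu>)\<in>UNIV. ginv g x \<mu> \<nu> *\<^sub>R (pd \<mu> \<phi> x * pd \<nu> \<phi> x)) +
      (\<Sum>i\<in>I. (\<alpha> i / fact i) *\<^sub>C \<phi> x ^ i)))"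

definition scalar_multiplet_density ::
  "real \<Rightarrow> ('a::finite \<Rightarrow> complex ^ 'k ^ 'k::finite) \<Rightarrow> ('a \<Rightarrow> 'v) \<Rightarrow> nat set \<Rightarrow> (nat \<Rightarrow> complex) \<Rightarrow>
    ('k \<Rightarrow> 's) \<Rightarrow> ('s, 'f, 'v, 'c, 'z::star_superalgebra) density" where
  "scalar_multiplet_density gc \<bb> A I \<alpha> \<Phi> g e F x =
    (let D = (\<lambda>\<mu> k. pd \<mu> (F (Scalar (\<Phi> k))) x +
          gauge_action gc \<bb> A F \<mu> (\<lambda>j. F (Scalar (\<Phi> j)) x) k x)
     in vol g x *\<^sub>R
      ((\<Sum>(\<mu>, \<nu>)\<in>UNIV. ginv g x \<mu> \<nu> *\<^sub>R (\<Sum>k\<in>UNIV. star (D \<mu> k) * D \<nu> k)) +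
       (\<Sum>i\<in>I. (\<alpha> i / fact i) *\<^sub>C (\<Sum>k\<in>UNIV. star (F (Scalar (\<Phi> k)) x) * F (Scalar (\<Phi> k)) x) ^ i)))"

text \<open>Component \<open>\<alpha>\<close> of the row \<open>(\<gamma>\<^sub>b \<psi>)\<^sup>\<dagger>\<close>, and its contraction with the vielbein at curved index 0.\<close>

definition conj_flat ::
  "(4 \<Rightarrow> complex ^ 4 ^ 4) \<Rightarrow> 'f \<Rightarrow> 4 \<Rightarrow> ('s, 'f, 'v, 'c, 'z::star_superalgebra) matter \<Rightarrow>
    4 \<Rightarrow> spacetime \<Rightarrow> 'z" where
  "conj_flat \<gamma> p b F \<alpha> x = star (\<Sum>\<beta>\<in>UNIV. \<gamma> b $ \<alpha> $ \<beta> *\<^sub>C F (Spinor p \<beta>) x)"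

definition dirac_conj ::
  "(4 \<Rightarrow> complex ^ 4 ^ 4) \<Rightarrow> 'f \<Rightarrow> matrix_field \<Rightarrow>
    ('s, 'f, 'v, 'c, 'z::star_superalgebra) matter \<Rightarrow> 4 \<Rightarrow> spacetime \<Rightarrow> 'z" where
  "dirac_conj \<gamma> p e F \<alpha> x = (\<Sum>b\<in>UNIV. (e x $ b $ 0) *\<^sub>R conj_flat \<gamma> p b F \<alpha> x)"

definition spin_derivative ::
  "(4 \<Rightarrow> complex ^ 4 ^ 4) \<Rightarrow> 'f \<Rightarrow> matrix_field \<Rightarrow> matrix_field \<Rightarrow>
    ('s, 'f, 'v, 'c, 'z::star_superalgebra) matter \<Rightarrow> 4 \<Rightarrow> 4 \<Rightarrow> spacetime \<Rightarrow> 'z" where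
  "spin_derivative \<gamma> p g e F \<mu> \<alpha> x = pd \<mu> (F (Spinor p \<alpha>)) x +
    (\<Sum>\<beta>\<in>UNIV. spin_connection \<gamma> g e x \<mu> $ \<alpha> $ \<beta> *\<^sub>C F (Spinor p \<beta>) x)"

text \<open>Spinor component \<open>\<alpha>\<close> of \<open>\<i> e\<^sup>\<mu>\<^sup>m \<gamma>\<^sub>m X\<^sub>\<mu>\<close>.\<close>

definition dirac_slash ::
  "(4 \<Rightarrow> complex ^ 4 ^ 4) \<Rightarrow> matrix_field \<Rightarrow> spacetime \<Rightarrow> (4 \<Rightarrow> 4 \<Rightarrow> 'z::star_superalgebra) \<Rightarrow> 4 \<Rightarrow> 'z" where
  "dirac_slash \<gamma> e x X \<alpha> =
    (\<Sum>(\<mu>, m, \<beta>)\<in>UNIV. vup e x \<mu> m *\<^sub>R ((\<i> * \<gamma> m $ \<alpha> $ \<beta>) *\<^sub>C X \<mu> \<beta>))"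

definition spinor_density ::
  "(4 \<Rightarrow> complex ^ 4 ^ 4) \<Rightarrow> real \<Rightarrow> 'f \<Rightarrow> ('s, 'f, 'v, 'c, 'z::star_superalgebra) density" where
  "spinor_density \<gamma> m p g e F x = vol g x *\<^sub>R (\<Sum>\<alpha>\<in>UNIV. dirac_conj \<gamma> p e F \<alpha> x *
    (dirac_slash \<gamma> e x (\<lambda>\<mu> \<beta>. spin_derivative \<gamma> p g e F \<mu> \<beta> x) \<alpha> - m *\<^sub>R F (Spinor p \<alpha>) x))"

text \<open>\<open>m\<close> is the diagonal of the mass matrix.\<close>

definition spinor_multiplet_density ::
  "(4 \<Rightarrow> complex ^ 4 ^ 4) \<Rightarrow> real \<Rightarrow> ('a::finite \<Rightarrow> complex ^ 'k ^ 'k::finite) \<Rightarrow> ('a \<Rightarrow> 'v) \<Rightarrow>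
    ('k \<Rightarrow> real) \<Rightarrow> ('k \<Rightarrow> 'f) \<Rightarrow> ('s, 'f, 'v, 'c, 'z::star_superalgebra) density" where
  "spinor_multiplet_density \<gamma> gc \<bb> A m \<Psi> g e F x =
    (let D = (\<lambda>k \<mu> \<beta>. spin_derivative \<gamma> (\<Psi> k) g e F \<mu> \<beta> x +
          gauge_action gc \<bb> A F \<mu> (\<lambda>j. F (Spinor (\<Psi> j) \<beta>) x) k x)
     in vol g x *\<^sub>R (\<Sum>(k, \<alpha>)\<in>UNIV. dirac_conj \<gamma> (\<Psi> k) e F \<alpha> x *
      (dirac_slash \<gamma> e x (D k) \<alpha> - m k *\<^sub>R F (Spinor (\<Psi> k) \<alpha>) x)))"

definition yukawa_density ::
  "(4 \<Rightarrow> complex ^ 4 ^ 4) \<Rightarrow> ('s::finite \<Rightarrow> 'f::finite \<Rightarrow> 'f \<Rightarrow> complex) \<Rightarrow>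
    ('s, 'f, 'v, 'c, 'z::star_superalgebra) density" where
  "yukawa_density \<gamma> \<alpha> g e F x = vol g x *\<^sub>R (- (\<Sum>(s, p, p')\<in>UNIV. \<alpha> s p p' *\<^sub>C (F (Scalar s) x *
    (\<Sum>b\<in>UNIV. (e x $ b $ 0) *\<^sub>R (\<Sum>\<beta>\<in>UNIV. conj_flat \<gamma> p b F \<beta> x * F (Spinor p' \<beta>) x)))))"

definition yang_mills_density ::
  "real \<Rightarrow> complex \<Rightarrow> ('a::finite \<Rightarrow> 'a \<Rightarrow> 'a \<Rightarrow> complex) \<Rightarrow> ('a \<Rightarrow> 'v) \<Rightarrow>
    ('s, 'f, 'v, 'c, 'z::star_superalgebra) density" where
  "yang_mills_density gc q f A g e F x = vol g x *\<^sub>R ((1 / (4 * gc\<^sup>2)) *\<^sub>R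
    (\<Sum>a\<in>UNIV. \<Sum>(\<mu>, \<nu>, \<rho>, \<sigma>)\<in>UNIV. (ginv g x \<mu> \<nu> * ginv g x \<rho> \<sigma>) *\<^sub>R
      (field_strength gc q f A F a \<mu> \<rho> x * field_strength gc q f A F a \<nu> \<sigma> x)))"

definition lorenz_gauge_density ::
  "real \<Rightarrow> ('a::finite \<Rightarrow> 'v) \<Rightarrow> ('s, 'f, 'v, 'c, 'z::star_superalgebra) density" where
  "lorenz_gauge_density \<xi> A g e F x = vol g x *\<^sub>R ((1 / (2 * \<xi>)) *\<^sub>R
    (\<Sum>a\<in>UNIV. \<Sum>(\<mu>, \<nu>, \<rho>, \<sigma>)\<in>UNIV. (ginv g x \<mu> \<nu> * ginv g x \<rho> \<sigma>) *\<^sub>R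
      (cov g \<mu> (\<lambda>\<kappa>. F (Vector (A a) \<kappa>)) \<nu> x * cov g \<rho> (\<lambda>\<kappa>. F (Vector (A a) \<kappa>)) \<sigma> x)))"

definition Z_gauge_density ::
  "real \<Rightarrow> real \<Rightarrow> 'v \<Rightarrow> 's \<Rightarrow> ('s, 'f, 'v, 'c, 'z::star_superalgebra) density" where
  "Z_gauge_density \<xi> m Z \<phi>Z g e F x =
    (let \<phi> = F (Scalar \<phi>Z) x; DZ = (\<lambda>\<mu> \<nu>. cov g \<mu> (\<lambda>\<kappa>. F (Vector Z \<kappa>)) \<nu> x)
     in vol g x *\<^sub>R
      ((1 / (2 * \<xi>)) *\<^sub>R (\<Sum>(\<mu>, \<nu>, \<rho>, \<sigma>)\<in>UNIV. (ginv g x \<mu> \<nu> * ginv g x \<rho> \<sigma>) *\<^sub>R (DZ \<mu> \<nu> * DZ \<rho> \<sigma>)) +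
       m *\<^sub>R (\<phi> * (\<Sum>(\<mu>, \<nu>)\<in>UNIV. ginv g x \<mu> \<nu> *\<^sub>R DZ \<mu> \<nu>)) +
       (\<xi> / 2 * m\<^sup>2) *\<^sub>R \<phi>\<^sup>2))"

definition W_gauge_density ::
  "real \<Rightarrow> real \<Rightarrow> 'v \<Rightarrow> 'v \<Rightarrow> 's \<Rightarrow> 's \<Rightarrow> ('s, 'f, 'v, 'c, 'z::star_superalgebra) density" where
  "W_gauge_density \<xi> m Wp Wm \<phi>Wp \<phi>Wm g e F x =
    (let \<phi>p = F (Scalar \<phi>Wp) x; \<phi>m = F (Scalar \<phi>Wm) x;
         DWp = (\<lambda>\<mu> \<nu>. cov g \<mu> (\<lambda>\<kappa>. F (Vector Wp \<kappa>)) \<nu> x);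
         DWm = (\<lambda>\<mu> \<nu>. cov g \<mu> (\<lambda>\<kappa>. F (Vector Wm \<kappa>)) \<nu> x)
     in vol g x *\<^sub>R
      ((1 / \<xi>) *\<^sub>R (\<Sum>(\<mu>, \<nu>, \<rho>, \<sigma>)\<in>UNIV. (ginv g x \<mu> \<nu> * ginv g x \<rho> \<sigma>) *\<^sub>R (DWm \<mu> \<nu> * DWp \<rho> \<sigma>)) +
       (\<xi> * m\<^sup>2) *\<^sub>R (\<phi>m * \<phi>p) +
       (\<i> * m) *\<^sub>C (\<Sum>(\<mu>, \<nu>)\<in>UNIV. ginv g x \<mu> \<nu> *\<^sub>R (\<phi>p * DWm \<mu> \<nu> - \<phi>m * DWp \<mu> \<nu>))))"

definition gauge_ghost_density ::
  "real \<Rightarrow> ('a::finite \<Rightarrow> 'a \<Rightarrow> 'a \<Rightarrow> complex) \<Rightarrow> ('a \<Rightarrow> 'v) \<Rightarrow> ('a \<Rightarrow> 'c) \<Rightarrow>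
    ('s, 'f, 'v, 'c, 'z::star_superalgebra) density" where
  "gauge_ghost_density gc f A c g e F x = vol g x *\<^sub>R
    ((\<Sum>(\<mu>, \<nu>)\<in>UNIV. ginv g x \<mu> \<nu> *\<^sub>R (\<Sum>a\<in>UNIV.
        F (Antighost (c a)) x * cov g \<mu> (\<lambda>\<kappa>. pd \<kappa> (F (Ghost (c a)))) \<nu> x)) +
     (\<i> * gc) *\<^sub>C (\<Sum>(\<mu>, \<nu>)\<in>UNIV. ginv g x \<mu> \<nu> *\<^sub>R (\<Sum>(a, b, d)\<in>UNIV. f a b d *\<^sub>C
        (F (Antighost (c a)) x *
          cov g \<mu> (\<lambda>\<kappa> y. F (Vector (A b) \<kappa>) y * F (Ghost (c d)) y) \<nu> x))))"

definition electroweak_ghost_density ::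
  "('s \<times> 'c \<times> 'c) set \<Rightarrow> ('c \<Rightarrow> real) \<Rightarrow> ('c \<Rightarrow> real) \<Rightarrow>
    ('s, 'f, 'v, 'c, 'z::star_superalgebra) density" where
  "electroweak_ghost_density J \<xi> m g e F x = vol g x *\<^sub>R (\<Sum>(s1, s2, s3)\<in>J.
    (\<xi> s2 * m s2) *\<^sub>R (F (Scalar s1) x * F (Antighost s2) x * F (Ghost s3) x))"

section \<open>Grassmann algebras as field values\<close>

text \<open>
  The complex Grassmann algebra over a finite linearly ordered set of generators:
  \<open>gcoeff x S\<close> is the coefficient of the ordered monomial in the generators belonging to \<open>S\<close>.
\<close>

datatype 'g grassmann = Grassmann (gcoeff: "'g set \<Rightarrow> complex")

text \<open>Sign of reordering the monomial of \<open>S\<close> followed by the monomial of \<open>T\<close>.\<close>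

definition gsign :: "'g::linorder set \<Rightarrow> 'g set \<Rightarrow> complex" where
  "gsign S T = (- 1) ^ card {(s, t) \<in> S \<times> T. t < s}"

lemma grassmann_eqI: "(\<And>S. gcoeff x S = gcoeff y S) \<Longrightarrow> x = y"
  by (auto intro: grassmann.expand)

lemma gsign_Un_left:
  fixes S T U :: "'g::{finite,linorder} set"
  assumes "S \<inter> T = {}"
  shows "gsign (S \<union> T) U = gsign S U * gsign T U"
proof -
  have "{(s, t) \<in> (S \<union> T) \<times> U. t < s} = {(s, t) \<in> S \<times> U. t < s} \<union> {(s, t) \<in> T \<times> U. t < s}"
    by auto
  moreover have "{(s, t) \<in> S \<times> U. t < s} \<inter> {(s, t) \<in> T \<times> U. t < s} = {}"
    using assms by auto
  ultimately show ?thesis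
    by (simp add: gsign_def card_Un_disjoint power_add)
qed

lemma gsign_Un_right:
  fixes S T U :: "'g::{finite,linorder} set"
  assumes "T \<inter> U = {}"
  shows "gsign S (T \<union> U) = gsign S T * gsign S U"
proof -
  have "{(s, t) \<in> S \<times> (T \<union> U). t < s} = {(s, t) \<in> S \<times> T. t < s} \<union> {(s, t) \<in> S \<times> U. t < s}"
    by auto
  moreover have "{(s, t) \<in> S \<times> T. t < s} \<inter> {(s, t) \<in> S \<times> U. t < s} = {}"
    using assms by auto
  ultimately show ?thesis
    by (simp add: gsign_def card_Un_disjoint power_add)
qed

lemma gsign_swap:
  fixes S T :: "'g::{finite,linorder} set"
  assumes "S \<inter> T = {}"
  shows "gsign T S = (- 1) ^ (card S * card T) * gsign S T"
proof -
  let ?A = "{(s, t) \<in> S \<times> T. t < s}" and ?B = "{(s, t) \<in> S \<times> T. s < t}"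
  have "card {(t, s) \<in> T \<times> S. s < t} = card (prod.swap ` ?B)"
    by (rule arg_cong[where f = card]) force
  also have "\<dots> = card ?B"
    by (rule card_image) simp
  finally have B: "gsign T S = (- 1) ^ card ?B"
    by (simp add: gsign_def)
  have "S \<times> T = ?A \<union> ?B"
    using assms by (auto simp: not_less dest!: order.order_iff_strict[THEN iffD1])
  moreover have "card (?A \<union> ?B) = card ?A + card ?B"
    by (rule card_Un_disjoint) auto
  ultimately have ST: "card S * card T = card ?A + card ?B"
    by (metis card_cartesian_product)
  have sign: "(- 1) ^ b = (- 1) ^ (a + b) * (- 1 :: complex) ^ a" for a b :: nat
    by (cases "even a") (simp_all add: power_add)
  show ?thesis
    unfolding B ST unfolding gsign_def by (rule sign)
qed

lemma gsign_empty [simp]: "gsign {} S = 1" "gsign S {} = 1"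
  by (simp_all add: gsign_def)

lemma norm_gsign [simp]: "norm (gsign S T) = 1"
  by (simp add: gsign_def norm_power)

lemma sum_Pow_flip:
  fixes S :: "'g::finite set"
  shows "(\<Sum>T\<in>Pow S. f T (S - T)) = (\<Sum>T\<in>Pow S. f (S - T) T)"
  by (rule sum.reindex_bij_witness[of _ "\<lambda>T. S - T" "\<lambda>T. S - T"]) (auto simp: double_diff)

definition gscale :: "complex \<Rightarrow> 'g grassmann \<Rightarrow> 'g grassmann" where
  "gscale a x = Grassmann (\<lambda>S. a * gcoeff x S)"

definition rev_sign :: "'g set \<Rightarrow> complex" where
  "rev_sign S = (- 1) ^ (card S choose 2)"

lemma sign_simps:
  "cnj (rev_sign S) = rev_sign S"
  "rev_sign S * (rev_sign S * z) = z"
  "(- 1) ^ n * ((- 1) ^ n * z) = (z :: complex)"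
proof -
  show cancel: "(- 1) ^ n * ((- 1) ^ n * z) = (z :: complex)" for n z
    by (cases "even n") simp_all
  show "cnj (rev_sign S) = rev_sign S" "rev_sign S * (rev_sign S * z) = z"
    by (simp_all add: rev_sign_def cancel)
qed

lemma rev_sign_split:
  fixes S T :: "'g::finite set"
  assumes "T \<subseteq> S"
  shows "rev_sign S = rev_sign T * rev_sign (S - T) * (- 1) ^ (card T * card (S - T))"
proof -
  have "card S = card T + card (S - T)"
    using assms by (metis Diff_disjoint Un_Diff_cancel card_Un_disjoint finite sup.absorb2)
  moreover have "(m + n) choose 2 = (m choose 2) + (n choose 2) + m * n" for m n :: nat
    by (induction n) (simp_all add: numeral_2_eq_2)
  ultimately show ?thesis
    by (simp add: rev_sign_def power_add)
qed

instantiation grassmann :: ("{finite,linorder}") star_superalgebra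
begin

definition "0 = Grassmann (\<lambda>S. 0)"
definition "1 = Grassmann (\<lambda>S. if S = {} then 1 else 0)"
definition "x + y = Grassmann (\<lambda>S. gcoeff x S + gcoeff y S)"
definition "x - y = Grassmann (\<lambda>S. gcoeff x S - gcoeff y S)"
definition "- x = Grassmann (\<lambda>S. - gcoeff x S)"
definition "x * y = Grassmann (\<lambda>S. \<Sum>T\<in>Pow S. gsign T (S - T) * gcoeff x T * gcoeff y (S - T))"
definition "r *\<^sub>R x = gscale (complex_of_real r) x"
definition "a *\<^sub>C x = gscale a x"
definition "norm x = (\<Sum>S\<in>UNIV. cmod (gcoeff x S))"
definition "sgn x = scaleR (inverse (norm x)) x" for x :: "'a grassmann"
definition "dist x y = norm (x - y)" for x y :: "'a grassmann"
definition uniformity_grassmann :: "('a grassmann \<times> 'a grassmann) filter" where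
  "uniformity_grassmann = (INF e\<in>{0<..}. principal {(x, y). dist x y < e})"
definition open_grassmann :: "'a grassmann set \<Rightarrow> bool" where
  "open_grassmann U \<longleftrightarrow> (\<forall>x\<in>U. \<forall>\<^sub>F (x', y) in uniformity. x' = x \<longrightarrow> y \<in> U)"
definition "star x = Grassmann (\<lambda>S. rev_sign S * cnj (gcoeff x S))"
definition "parity x = Grassmann (\<lambda>S. (- 1) ^ card S * gcoeff x S)"

lemmas gcoeff_defs =
  zero_grassmann_def one_grassmann_def plus_grassmann_def minus_grassmann_def uminus_grassmann_def
  times_grassmann_def scaleR_grassmann_def scaleC_grassmann_def gscale_def star_grassmann_def
  parity_grassmann_def

instance
proof
  fix x y z :: "'a grassmann" and r s :: real and a b :: complex
  show "x + y + z = x + (y + z)" "x + y = y + x" "0 + x = x" "- x + x = 0" "x - y = x + - y"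
    by (rule grassmann_eqI; simp add: gcoeff_defs)+
  show "r *\<^sub>R (x + y) = r *\<^sub>R x + r *\<^sub>R y" "(r + s) *\<^sub>R x = r *\<^sub>R x + s *\<^sub>R x"
    "r *\<^sub>R s *\<^sub>R x = (r * s) *\<^sub>R x" "1 *\<^sub>R x = x"
    by (rule grassmann_eqI; simp add: gcoeff_defs algebra_simps)+
  show "a *\<^sub>C (x + y) = a *\<^sub>C x + a *\<^sub>C y" "(a + b) *\<^sub>C x = a *\<^sub>C x + b *\<^sub>C x"
    "a *\<^sub>C b *\<^sub>C x = (a * b) *\<^sub>C x" "r *\<^sub>R x = complex_of_real r *\<^sub>C x"
    by (rule grassmann_eqI; simp add: gcoeff_defs algebra_simps)+
  show "dist x y = norm (x - y)" "sgn x = scaleR (inverse (norm x)) x"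
    by (simp_all add: dist_grassmann_def sgn_grassmann_def)
  show "uniformity = (INF e\<in>{0<..}. principal {(x::'a grassmann, y). dist x y < e})"
    by (rule uniformity_grassmann_def)
  show "open U \<longleftrightarrow> (\<forall>x\<in>U. \<forall>\<^sub>F (x', y) in uniformity. x' = x \<longrightarrow> y \<in> U)" for U :: "'a grassmann set"
    by (rule open_grassmann_def)
  have "norm x = 0 \<longleftrightarrow> (\<forall>S. gcoeff x S = 0)"
    by (simp add: norm_grassmann_def sum_nonneg_eq_0_iff)
  also have "\<dots> \<longleftrightarrow> x = 0"
    by (auto simp: zero_grassmann_def intro: grassmann_eqI)
  finally show "norm x = 0 \<longleftrightarrow> x = 0" .
  show "norm (x + y) \<le> norm x + norm y"
    by (auto simp: norm_grassmann_def plus_grassmann_def norm_triangle_ineq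
        intro!: sum_mono simp flip: sum.distrib)
  show "norm (r *\<^sub>R x) = \<bar>r\<bar> * norm x" "norm (a *\<^sub>C x) = cmod a * norm x"
    by (simp_all add: norm_grassmann_def gcoeff_defs norm_mult sum_distrib_left)
  show "norm (1 :: 'a grassmann) = 1"
    by (simp add: norm_grassmann_def one_grassmann_def if_distrib[where f = cmod] cong: if_cong)
  have "gcoeff 0 {} \<noteq> gcoeff (1 :: 'a grassmann) {}"
    by (simp add: zero_grassmann_def one_grassmann_def)
  then show "0 \<noteq> (1 :: 'a grassmann)"
    by metis
  show "norm (star x) = norm x" "norm (parity x) = norm x"
    by (simp_all add: norm_grassmann_def gcoeff_defs rev_sign_def norm_mult norm_power)
  show "(x + y) * z = x * z + y * z" "x * (y + z) = x * y + x * z"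
    "(r *\<^sub>R x) * y = r *\<^sub>R (x * y)" "x * (r *\<^sub>R y) = r *\<^sub>R (x * y)"
    "(a *\<^sub>C x) * y = a *\<^sub>C (x * y)" "x * (a *\<^sub>C y) = a *\<^sub>C (x * y)"
    by (rule grassmann_eqI; simp add: gcoeff_defs algebra_simps sum.distrib sum_distrib_left)+
  show "1 * x = x"
  proof (rule grassmann_eqI)
    fix S
    have "gcoeff (1 * x) S = (\<Sum>T\<in>Pow S. if T = {} then gcoeff x S else 0)"
      unfolding times_grassmann_def one_grassmann_def grassmann.sel by (rule sum.cong) auto
    then show "gcoeff (1 * x) S = gcoeff x S"
      by simp
  qed
  show "x * 1 = x"
  proof (rule grassmann_eqI)
    fix S
    have "gcoeff (x * 1) S = (\<Sum>T\<in>Pow S. if T = S then gcoeff x S else 0)"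
      unfolding times_grassmann_def one_grassmann_def grassmann.sel by (rule sum.cong) auto
    then show "gcoeff (x * 1) S = gcoeff x S"
      by simp
  qed
  show "x * y * z = x * (y * z)"
  proof (rule grassmann_eqI)
    fix S :: "'a set"
    have "gcoeff (x * y * z) S = (\<Sum>(U, T)\<in>Sigma (Pow S) Pow. gsign U (S - U) * gsign T (U - T) *
        (gcoeff x T * gcoeff y (U - T) * gcoeff z (S - U)))"
      by (simp add: times_grassmann_def sum_distrib_left sum_distrib_right mult_ac
          flip: sum.Sigma)
    also have "\<dots> = (\<Sum>(T, V)\<in>Sigma (Pow S) (\<lambda>T. Pow (S - T)). gsign T (S - T) * gsign V (S - T - V) *
        (gcoeff x T * gcoeff y V * gcoeff z (S - T - V)))"
    proof (rule sum.reindex_bij_witness[of _ "\<lambda>(T, V). (T \<union> V, T)" "\<lambda>(U, T). (T, U - T)"])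
      fix p :: "'a set \<times> 'a set" assume "p \<in> Sigma (Pow S) Pow"
      then obtain U T where p: "p = (U, T)" "T \<subseteq> U" "U \<subseteq> S" by auto
      define V W where "V = U - T" and "W = S - U"
      have "U = T \<union> V" "S - T = V \<union> W" "T \<inter> V = {}" "V \<inter> W = {}" "S - T - V = W"
        using p by (auto simp: V_def W_def)
      then show "(case case p of (U, T) \<Rightarrow> (T, U - T) of (T, V) \<Rightarrow>
          gsign T (S - T) * gsign V (S - T - V) * (gcoeff x T * gcoeff y V * gcoeff z (S - T - V))) =
        (case p of (U, T) \<Rightarrow> gsign U (S - U) * gsign T (U - T) *
          (gcoeff x T * gcoeff y (U - T) * gcoeff z (S - U)))"
        unfolding p(1) prod.case V_def[symmetric] W_def[symmetric]
        by (simp add: gsign_Un_left gsign_Un_right)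
    qed auto
    also have "\<dots> = gcoeff (x * (y * z)) S"
      by (simp add: times_grassmann_def sum_distrib_left sum_distrib_right mult_ac
          flip: sum.Sigma)
    finally show "gcoeff (x * y * z) S = gcoeff (x * (y * z)) S" .
  qed
  show "norm (x * y) \<le> norm x * norm y"
  proof -
    have "norm (x * y) \<le> (\<Sum>S\<in>UNIV. \<Sum>T\<in>Pow S. cmod (gcoeff x T) * cmod (gcoeff y (S - T)))"
      unfolding norm_grassmann_def times_grassmann_def grassmann.sel
      by (intro sum_mono sum_norm_le) (simp add: norm_mult)
    also have "\<dots> = (\<Sum>(S, T)\<in>Sigma UNIV Pow. cmod (gcoeff x T) * cmod (gcoeff y (S - T)))"
      by (simp add: sum.Sigma)
    also have "\<dots> = (\<Sum>(T, V)\<in>{(T, V). T \<inter> V = {}}. cmod (gcoeff x T) * cmod (gcoeff y V))"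
      by (rule sum.reindex_bij_witness[of _ "\<lambda>(T, V). (T \<union> V, T)" "\<lambda>(S, T). (T, S - T)"]) auto
    also have "\<dots> \<le> (\<Sum>(T, V)\<in>UNIV \<times> UNIV. cmod (gcoeff x T) * cmod (gcoeff y V))"
      by (rule sum_mono2) auto
    also have "\<dots> = norm x * norm y"
      by (simp add: norm_grassmann_def sum_product sum.cartesian_product)
    finally show ?thesis .
  qed
  show "star (x + y) = star x + star y" "star (a *\<^sub>C x) = cnj a *\<^sub>C star x"
    "star (star x) = x" "parity (x + y) = parity x + parity y"
    "parity (a *\<^sub>C x) = a *\<^sub>C parity x" "parity (parity x) = x" "parity (star x) = star (parity x)"
    by (rule grassmann_eqI; simp add: gcoeff_defs sign_simps distrib_left mult.left_commute)+
  show "star (x * y) = star y * star x"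
  proof (rule grassmann_eqI)
    fix S :: "'a set"
    have "gcoeff (star y * star x) S =
        (\<Sum>T\<in>Pow S. gsign T (S - T) * (rev_sign T * cnj (gcoeff y T)) * (rev_sign (S - T) * cnj (gcoeff x (S - T))))"
      by (simp add: times_grassmann_def star_grassmann_def)
    also have "\<dots> =
        (\<Sum>T\<in>Pow S. gsign (S - T) T * (rev_sign (S - T) * cnj (gcoeff y (S - T))) * (rev_sign T * cnj (gcoeff x T)))"
      by (rule sum_Pow_flip)
    also have "\<dots> = (\<Sum>T\<in>Pow S. rev_sign S * (gsign T (S - T) * cnj (gcoeff x T) * cnj (gcoeff y (S - T))))"
    proof (rule sum.cong[OF refl])
      fix T assume "T \<in> Pow S"
      then have "T \<subseteq> S" by simp
      show "gsign (S - T) T * (rev_sign (S - T) * cnj (gcoeff y (S - T))) * (rev_sign T * cnj (gcoeff x T)) =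
          rev_sign S * (gsign T (S - T) * cnj (gcoeff x T) * cnj (gcoeff y (S - T)))"
        unfolding rev_sign_split[OF \<open>T \<subseteq> S\<close>] by (subst gsign_swap) (auto simp: mult_ac)
    qed
    also have "\<dots> = gcoeff (star (x * y)) S"
      by (simp add: times_grassmann_def star_grassmann_def sum_distrib_left sign_simps gsign_def)
    finally show "gcoeff (star (x * y)) S = gcoeff (star y * star x) S" by simp
  qed
  show "parity (x * y) = parity x * parity y"
  proof (rule grassmann_eqI)
    fix S :: "'a set"
    have "(- 1) ^ card S = (- 1) ^ card T * (- 1 :: complex) ^ card (S - T)" if "T \<subseteq> S" for T
      using that by (metis Diff_disjoint Un_Diff_cancel card_Un_disjoint finite power_add sup.absorb2)
    then show "gcoeff (parity (x * y)) S = gcoeff (parity x * parity y) S"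
      by (auto simp: times_grassmann_def parity_grassmann_def sum_distrib_left intro!: sum.cong)
  qed
  have flip: "gcoeff (y * x) S =
      (\<Sum>T\<in>Pow S. (- 1) ^ (card T * card (S - T)) * (gsign T (S - T) * gcoeff x T * gcoeff y (S - T)))"
    for S :: "'a set" and x y :: "'a grassmann"
  proof -
    have "gcoeff (y * x) S = (\<Sum>T\<in>Pow S. gsign (S - T) T * gcoeff y (S - T) * gcoeff x T)"
      unfolding times_grassmann_def grassmann.sel by (rule sum_Pow_flip)
    also have "\<dots> = (\<Sum>T\<in>Pow S. (- 1) ^ (card T * card (S - T)) * (gsign T (S - T) * gcoeff x T * gcoeff y (S - T)))"
      by (rule sum.cong[OF refl], subst gsign_swap) (auto simp: mult_ac)
    finally show ?thesis .
  qed
  show "x * y = y * x" if "parity x = x"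
  proof (rule grassmann_eqI)
    fix S :: "'a set"
    have x0: "gcoeff x T = 0" if "odd (card T)" for T
      using arg_cong[OF \<open>parity x = x\<close>, of "\<lambda>w. gcoeff w T"] that
      by (simp add: parity_grassmann_def)
    show "gcoeff (x * y) S = gcoeff (y * x) S"
      unfolding flip times_grassmann_def[of x y] grassmann.sel
    proof (rule sum.cong[OF refl])
      fix T assume "T \<in> Pow S"
      show "gsign T (S - T) * gcoeff x T * gcoeff y (S - T) =
          (- 1) ^ (card T * card (S - T)) * (gsign T (S - T) * gcoeff x T * gcoeff y (S - T))"
        by (cases "even (card T)") (simp_all add: x0)
    qed
  qed
  show "x * y = - (y * x)" if "parity x = - x" "parity y = - y"
  proof (rule grassmann_eqI)
    fix S :: "'a set"
    have 0: "gcoeff w T = 0" if "even (card T)" "parity w = - w" for T and w :: "'a grassmann"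
      using arg_cong[OF that(2), of "\<lambda>w. gcoeff w T"] that(1)
      by (simp add: parity_grassmann_def uminus_grassmann_def)
    have "gcoeff (x * y) S = (\<Sum>T\<in>Pow S. gsign T (S - T) * gcoeff x T * gcoeff y (S - T))"
      by (simp add: times_grassmann_def)
    also have "\<dots> = (\<Sum>T\<in>Pow S. - ((- 1) ^ (card T * card (S - T)) *
        (gsign T (S - T) * gcoeff x T * gcoeff y (S - T))))"
    proof (rule sum.cong[OF refl])
      fix T assume "T \<in> Pow S"
      show "gsign T (S - T) * gcoeff x T * gcoeff y (S - T) =
          - ((- 1) ^ (card T * card (S - T)) * (gsign T (S - T) * gcoeff x T * gcoeff y (S - T)))"
        using 0[OF _ that(1)] 0[OF _ that(2)]
        by (cases "even (card T)"; cases "even (card (S - T))") simp_all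
    qed
    also have "\<dots> = gcoeff (- (y * x)) S"
      by (simp add: uminus_grassmann_def flip sum_negf)
    finally show "gcoeff (x * y) S = gcoeff (- (y * x)) S" .
  qed
qed

end

end

theory Submission
  imports Defs
begin

text \<open>
  Expanding the covariant derivatives \<open>\<nabla>\<^sub>\<mu> A\<^sub>\<nu> = \<partial>\<^sub>\<mu> A\<^sub>\<nu> - \<Gamma>\<^sub>\<mu>\<^sub>\<nu>\<^sup>\<tau> A\<^sub>\<tau>\<close> sorts every bosonic and ghost density
  into types 1 to 6; at most two Christoffel symbols occur, each traced with its own inverse metric.
  The Dirac conjugate contributes one factor \<open>e\<^sub>0\<^sup>o\<close> and the Dirac operator one factor \<open>e\<^sup>\<rho>\<^sup>r\<close>, which
  gives types 7 and 8 for the mass, Yukawa and (gauge-covariant) derivative terms.  In the spin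
  connection the derivative falls on an inverse vielbein; differentiating
  \<open>e\<^sub>\<nu>\<^sup>s e\<^sup>\<nu>\<^sup>t = \<eta>\<^sup>s\<^sup>t\<close> moves it to the vielbein, so that
  \<open>\<omega>\<^sub>\<mu>\<^sup>s\<^sup>t = e\<^sub>\<nu>\<^sup>s \<Gamma>\<^sub>\<mu>\<^sub>\<rho>\<^sup>\<nu> e\<^sup>\<rho>\<^sup>t - (\<partial>\<^sub>\<mu> e\<^sub>\<nu>\<^sup>s) e\<^sup>\<nu>\<^sup>t\<close> yields exactly types 10 and 9.
\<close>

section \<open>Vielbein and spin connection\<close>

lemma pd_eqI: "(f has_derivative f') (at x) \<Longrightarrow> pd \<mu> f x = f' (axis \<mu> 1)"
  unfolding pd_def by (metis frechet_derivative_at)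

lemma has_frechet_derivative: "f differentiable at x \<Longrightarrow> (f has_derivative frechet_derivative f (at x)) (at x)"
  by (simp add: frechet_derivative_works)

lemma pd_const: "pd \<mu> (\<lambda>y. k) x = 0"
  by (simp add: pd_eqI[OF has_derivative_const])

lemma pd_mult:
  fixes u v :: "spacetime \<Rightarrow> 'b::real_normed_algebra"
  assumes "u differentiable at x" "v differentiable at x"
  shows "pd \<mu> (\<lambda>y. u y * v y) x = pd \<mu> u x * v x + u x * pd \<mu> v x"
  using pd_eqI[OF has_derivative_mult[OF assms[THEN has_frechet_derivative]]]
  by (simp add: pd_def add.commute)

lemma pd_sum:
  assumes "\<And>i. i \<in> I \<Longrightarrow> u i differentiable at x"
  shows "pd \<mu> (\<lambda>y. \<Sum>i\<in>I. u i y) x = (\<Sum>i\<in>I. pd \<mu> (u i) x)"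
  using pd_eqI[OF has_derivative_sum[OF assms[THEN has_frechet_derivative]]] by (simp add: pd_def)

lemma smooth_differentiable: "smooth u \<Longrightarrow> u differentiable at x"
  unfolding smooth_def by (metis foldr_Nil id_apply)

lemma differentiable_vec_nth:
  "u differentiable at x \<Longrightarrow> (\<lambda>y. u y $ i) differentiable at x"
  unfolding differentiable_def
  using bounded_linear.has_derivative[OF bounded_linear_vec_nth] by blast

lemma differentiable_prod:
  fixes u :: "'i \<Rightarrow> 'b::real_normed_vector \<Rightarrow> real"
  assumes "\<And>i. i \<in> I \<Longrightarrow> u i differentiable at x"
  shows "(\<lambda>y. \<Prod>i\<in>I. u i y) differentiable at x"
  by (rule differentiableI[OF has_derivative_prod[OF has_frechet_derivative[OF assms]]])

lemma differentiable_det: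
  fixes M :: "'b::real_normed_vector \<Rightarrow> real ^ 'n ^ 'n"
  assumes "\<And>i j. (\<lambda>y. M y $ i $ j) differentiable at x"
  shows "(\<lambda>y. det (M y)) differentiable at x"
  unfolding det_def
  by (intro differentiable_sum ballI differentiable_mult differentiable_const differentiable_prod
      assms finite_permutations finite)

section \<open>Differentiability of the matrix inverse\<close>

lemma matrix_inv_right: "invertible M \<Longrightarrow> M ** matrix_inv M = mat 1"
  unfolding invertible_def matrix_inv_def by (drule someI_ex) blast

text \<open>Column \<open>m\<close> of the inverse solves \<open>M *v x = axis m 1\<close>, so
  Cramer's rule applies. The quotient of determinants reduces differentiability of the inverse to
  that of \<open>det\<close>.\<close>

lemma matrix_inv_cramer:
  fixes M :: "real ^ 'n ^ 'n"
  assumes "invertible M"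
  shows "matrix_inv M $ k $ m = det (\<chi> i j. if j = k then axis m 1 $ i else M $ i $ j) / det M"
proof -
  have "M *v (matrix_inv M *v axis m 1) = axis m 1"
    by (simp add: matrix_vector_mul_assoc matrix_inv_right[OF assms])
  then have "matrix_inv M *v axis m 1 = (\<chi> k. det (\<chi> i j. if j = k then axis m 1 $ i else M $ i $ j) / det M)"
    using cramer[of M] assms by (simp add: invertible_det_nz)
  then show ?thesis
    by (simp add: vec_eq_iff matrix_vector_mul_component inner_axis)
qed

lemma differentiable_matrix_inv:
  fixes M :: "'b::real_normed_vector \<Rightarrow> real ^ 'n ^ 'n"
  assumes "\<And>i j. (\<lambda>y. M y $ i $ j) differentiable at x" "\<And>y. invertible (M y)"
  shows "(\<lambda>y. matrix_inv (M y) $ k $ m) differentiable at x"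
proof -
  \<comment> \<open>Column \<open>k\<close> has been replaced by a constant vector; every other
    entry is an entry of \<open>M y\<close>.\<close>
  have "(\<lambda>y. (\<chi> i j. if j = k then axis m 1 $ i else M y $ i $ j) $ a $ b) differentiable at x" for a b
    by (cases "b = k") (simp_all add: assms)
  then show ?thesis
    unfolding matrix_inv_cramer[OF assms(2)]
    by (intro differentiable_divide differentiable_det assms(1))
      (use assms(2) in \<open>auto simp: invertible_det_nz\<close>)
qed

text \<open>A kernel vector would be orthogonal to the timelike vector, hence of negative square.\<close>

lemma lorentzian_invertible:
  assumes "lorentzian G"
  shows "invertible G"
proof -
  obtain v where v: "\<And>w. w \<noteq> 0 \<Longrightarrow> v \<bullet> (G *v w) = 0 \<Longrightarrow> w \<bullet> (G *v w) < 0"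
    using assms by (auto simp: lorentzian_def)
  have "w = 0" if "G *v w = 0" for w
    using v[of w] that by (cases "w = 0") simp_all
  then show ?thesis
    by (metis invertible_left_inverse matrix_left_invertible_ker)
qed

section \<open>The inverse vielbein and the spin connection\<close>

text \<open>The metric factors through the vielbein, so a kernel vector of \<open>e x\<close> is
  also one of the metric, which is invertible because it is Lorentzian.\<close>

lemma vielbein_invertible:
  assumes "graviton_background \<kappa> h e"
  shows "invertible (e x)"
proof -
  have "w = 0" if "e x *v w = 0" for w
  proof -
    let ?g = "metric \<kappa> h x"
    have "(\<Sum>\<nu>\<in>UNIV. e x $ n $ \<nu> * w $ \<nu>) = 0" for n
      using that by (simp add: vec_eq_iff matrix_vector_mult_def)
    moreover have "(?g *v w) $ \<mu> =
        (\<Sum>\<nu>\<in>UNIV. \<Sum>m\<in>UNIV. \<Sum>n\<in>UNIV. eta m n * e x $ m $ \<mu> * (e x $ n $ \<nu> * w $ \<nu>))" for \<mu>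
      using assms unfolding graviton_background_def matrix_vector_mult_def
      by (simp add: sum_distrib_right sum.cartesian_product mult.assoc split_def)
    \<comment> \<open>Moving the sum over the curved index innermost exhibits the factor
      \<open>e x *v w\<close>, which vanishes.\<close>
    moreover have "\<dots> \<mu> =
        (\<Sum>m\<in>UNIV. \<Sum>n\<in>UNIV. eta m n * e x $ m $ \<mu> * (\<Sum>\<nu>\<in>UNIV. e x $ n $ \<nu> * w $ \<nu>))" for \<mu>
      unfolding sum_distrib_left by (subst sum.swap) (intro sum.cong refl sum.swap)
    ultimately have "?g *v w = 0"
      by (simp add: vec_eq_iff)
    moreover have "invertible ?g"
      using assms by (auto simp: graviton_background_def intro: lorentzian_invertible)
    ultimately show "w = 0"
      by (metis invertible_left_inverse matrix_left_invertible_ker)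
  qed
  then show ?thesis
    by (metis invertible_left_inverse matrix_left_invertible_ker)
qed

text \<open>This is \<open>e ** matrix_inv e = mat 1\<close> with one flat index raised. The
  right-hand side is independent of the point, which makes its derivative vanish in
  \<open>omega_eq\<close>.\<close>

lemma vielbein_vup:
  assumes "graviton_background \<kappa> h e"
  shows "(\<Sum>\<nu>\<in>UNIV. e x $ s $ \<nu> * vup e x \<nu> t) = eta t s"
proof -
  have "(\<Sum>\<nu>\<in>UNIV. e x $ s $ \<nu> * vup e x \<nu> t) =
      (\<Sum>\<nu>\<in>UNIV. \<Sum>n\<in>UNIV. eta t n * (e x $ s $ \<nu> * matrix_inv (e x) $ \<nu> $ n))"
    by (simp add: vup_def vinv_def sum_distrib_left mult.left_commute)
  also have "\<dots> = (\<Sum>n\<in>UNIV. eta t n * (e x ** matrix_inv (e x)) $ s $ n)"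
    by (subst sum.swap) (simp add: matrix_matrix_mult_def sum_distrib_left)
  also have "\<dots> = eta t s"
    by (simp add: matrix_inv_right[OF vielbein_invertible[OF assms]] mat_def if_distrib cong: if_cong)
  finally show ?thesis .
qed

lemma omega_eq:
  assumes "graviton_background \<kappa> h e"
  shows "omega g e x \<mu> s t =
    (\<Sum>\<nu>\<in>UNIV. \<Sum>\<rho>\<in>UNIV. e x $ s $ \<nu> * christoffel g x \<mu> \<rho> \<nu> * vup e x \<rho> t) -
    (\<Sum>\<nu>\<in>UNIV. pd \<mu> (\<lambda>y. e y $ s $ \<nu>) x * vup e x \<nu> t)"
proof -
  have e: "(\<lambda>y. e y $ i $ j) differentiable at x" for i j
    using assms by (intro differentiable_vec_nth) (simp add: graviton_background_def smooth_differentiable)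
  \<comment> \<open>The product rule below needs the inverse vielbein to be differentiable; its
    entries are Cramer quotients with nonvanishing denominator.\<close>
  have vup: "(\<lambda>y. vup e y \<nu> t) differentiable at x" for \<nu>
    unfolding vup_def vinv_def
    by (intro differentiable_sum ballI differentiable_mult differentiable_const
        differentiable_matrix_inv e vielbein_invertible[OF assms] finite)
  have "0 = pd \<mu> (\<lambda>y. \<Sum>\<nu>\<in>UNIV. e y $ s $ \<nu> * vup e y \<nu> t) x"
    by (simp add: vielbein_vup[OF assms] pd_const)
  also have "\<dots> = (\<Sum>\<nu>\<in>UNIV. pd \<mu> (\<lambda>y. e y $ s $ \<nu>) x * vup e x \<nu> t) +
      (\<Sum>\<nu>\<in>UNIV. e x $ s $ \<nu> * pd \<mu> (\<lambda>y. vup e y \<nu> t) x)"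
    by (simp add: pd_sum pd_mult e vup sum.distrib)
  finally show ?thesis
    by (simp add: omega_def distrib_left sum.distrib sum_distrib_left mult.assoc)
qed

section \<open>Sums of interaction terms\<close>

text \<open>A complex factor becomes multiplication by a constant element, so that laws for left
  multiplication carry over to \<open>scaleC\<close>.\<close>

lemma scaleC_conv_mult: "a *\<^sub>C x = (a *\<^sub>C 1) * x"
  by (simp add: mult_scaleC_left)

lemma scaleC_sum_right: "a *\<^sub>C (\<Sum>i\<in>I. u i) = (\<Sum>i\<in>I. a *\<^sub>C u i)"
  by (subst (1 2) scaleC_conv_mult) (rule sum_distrib_left)

lemma scaleC_zero_left: "0 *\<^sub>C x = 0"
  using scaleR_scaleC[of 0 x] by simp

lemma scaleC_one_left: "1 *\<^sub>C x = x"
  using scaleR_scaleC[of 1 x] by simp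

lemma scaleC_sum_left: "(\<Sum>i\<in>I. a i) *\<^sub>C x = (\<Sum>i\<in>I. a i *\<^sub>C x)"
  by (induction I rule: infinite_finite_induct) (simp_all add: scaleC_add_left scaleC_zero_left)

lemma scaleC_scaleR_right: "a *\<^sub>C (r *\<^sub>R x) = r *\<^sub>R (a *\<^sub>C x)"
  by (simp add: scaleR_scaleC scaleC_scaleC mult.commute)

lemma sum_UNIV_prod:
  "(\<Sum>p\<in>(UNIV :: ('a::finite \<times> 'b::finite) set). u p) = (\<Sum>a\<in>UNIV. \<Sum>b\<in>UNIV. u (a, b))"
  by (simp add: sum.cartesian_product)

section \<open>Closure properties of graviton-free matter functionals\<close>

lemma matter_built_scaleC: "matter_built T \<Longrightarrow> matter_built (\<lambda>F x. a *\<^sub>C T F x)"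
  using mult[OF const[of a], of T] by (simp add: mult_scaleC_left)

lemma matter_built_scaleR: "matter_built T \<Longrightarrow> matter_built (\<lambda>F x. r *\<^sub>R T F x)"
  by (simp add: scaleR_scaleC matter_built_scaleC)

lemma matter_built_uminus: "matter_built T \<Longrightarrow> matter_built (\<lambda>F x. - T F x)"
  using matter_built_scaleR[of T "- 1"] by simp

lemma matter_built_diff:
  "matter_built S \<Longrightarrow> matter_built T \<Longrightarrow> matter_built (\<lambda>F x. S F x - T F x)"
  using add[OF _ matter_built_uminus, of S T] by simp

lemma matter_built_one: "matter_built (\<lambda>F x. 1)"
  using const[of 1] by (simp add: scaleC_one_left)

lemma matter_built_zero: "matter_built (\<lambda>F x. 0)"
  using matter_built_scaleR[OF matter_built_one, of 0] by simp

lemma matter_built_power: "matter_built T \<Longrightarrow> matter_built (\<lambda>F x. T F x ^ n)"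
  by (induction n) (simp_all add: matter_built_one mult)

text \<open>A sum over an infinite index set is 0 by convention, so that case falls under
  \<open>matter_built_zero\<close>.\<close>

lemma matter_built_sum:
  "(\<And>i. i \<in> I \<Longrightarrow> matter_built (T i)) \<Longrightarrow> matter_built (\<lambda>F x. \<Sum>i\<in>I. T i F x)"
  by (induction I rule: infinite_finite_induct) (simp_all add: matter_built_zero add)

lemma matter_built_case_prod:
  "(\<And>a b. matter_built (T a b)) \<Longrightarrow> matter_built (\<lambda>F x. case p of (a, b) \<Rightarrow> T a b F x)"
  by (cases p) simp

lemma matter_built_field: "matter_built (\<lambda>F. F l)"
  using field[of "[]" l] by simp

lemma matter_built_pd: "matter_built (\<lambda>F. pd \<mu> (F l))"
  using field[of "[\<mu>]" l] by simp

lemma matter_built_pd_pd: "matter_built (\<lambda>F. pd \<mu> (pd \<nu> (F l)))"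
  using field[of "[\<mu>, \<nu>]" l] by simp

lemmas matter_built_intros =
  matter_built_field matter_built_pd matter_built_pd_pd matter_built_zero matter_built_one
  matter_built_scaleC matter_built_scaleR matter_built_uminus matter_built_diff matter_built_power
  matter_built_sum matter_built_case_prod adjoint add mult

lemma matter_built_conj_flat: "matter_built (\<lambda>F. conj_flat \<gamma> p b F \<alpha>)"
  unfolding conj_flat_def by (intro matter_built_intros)

lemma matter_built_gauge_action:
  "(\<And>j. matter_built (X j)) \<Longrightarrow> matter_built (\<lambda>F x. gauge_action gc \<bb> A F \<mu> (\<lambda>j. X j F x) k x)"
  unfolding gauge_action_def by (intro matter_built_intros)

lemma matter_built_field_strength: "matter_built (\<lambda>F. field_strength gc q f A F a \<mu> \<nu>)"
  unfolding field_strength_def by (intro matter_built_intros)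

section \<open>Closure properties of interaction terms and their finite sums\<close>

text \<open>The gravitational coefficients are real scalars, so \<open>S\<close> moves past them and
  is absorbed into the array \<open>T\<close> without changing the type. It stays on the left of
  \<open>T\<close> because field values need not commute.\<close>

lemma interaction_term_mult_left:
  assumes "interaction_term L" "matter_built S"
  shows "interaction_term (\<lambda>g e F x. S F x * L g e F x)"
  using assms(1)
proof cases
  case (type1 T)
  then show ?thesis
    using interaction_term.type1[OF mult[OF assms(2), of T]] by simp
next
  case (type2 T)
  then show ?thesis
    using interaction_term.type2[OF mult[OF assms(2), of "T _ _"]]
    by (simp add: sum_distrib_left split_def)
next
  case (type3 T)
  then show ?thesis
    using interaction_term.type3[OF mult[OF assms(2), of "T _ _ _ _"]]
    by (simp add: sum_distrib_left split_def)
next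
  case (type4 T)
  then show ?thesis
    using interaction_term.type4[OF mult[OF assms(2), of "T _"]]
    by (simp add: sum_distrib_left split_def)
next
  case (type5 T)
  then show ?thesis
    using interaction_term.type5[OF mult[OF assms(2), of "T _ _ _"]]
    by (simp add: sum_distrib_left split_def)
next
  case (type6 T)
  then show ?thesis
    using interaction_term.type6[OF mult[OF assms(2), of "T _ _"]]
    by (simp add: sum_distrib_left split_def)
next
  case (type7 T)
  then show ?thesis
    using interaction_term.type7[OF mult[OF assms(2), of "T _"]]
    by (simp add: sum_distrib_left)
next
  case (type8 T)
  then show ?thesis
    using interaction_term.type8[OF mult[OF assms(2), of "T _ _ _"]]
    by (simp add: sum_distrib_left split_def)
next
  case (type9 T)
  then show ?thesis
    using interaction_term.type9[OF mult[OF assms(2), of "T _ _ _ _"]]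
    by (simp add: sum_distrib_left split_def)
next
  case (type10 T)
  then show ?thesis
    using interaction_term.type10[OF mult[OF assms(2), of "T _ _ _ _"]]
    by (simp add: sum_distrib_left split_def)
qed

lemma interaction_term_decomposable:
  "interaction_term L \<Longrightarrow> finite_sum_of_interaction_terms R L"
  unfolding finite_sum_of_interaction_terms_def by (rule exI[of _ "[L]"]) simp

lemma decomposable_zero: "finite_sum_of_interaction_terms R (\<lambda>g e F x. 0)"
  unfolding finite_sum_of_interaction_terms_def by (rule exI[of _ "[]"]) simp

text \<open>The two densities are compared only on admissible backgrounds and configurations. This
  makes the vielbein identity for \<open>omega\<close> and the smoothness of the fields available
  when a density is rewritten.\<close>

lemma decomposable_cong:
  assumes "finite_sum_of_interaction_terms R L"
    and "\<And>\<kappa> h e F x. graviton_background \<kappa> h e \<Longrightarrow> matter_configuration R F \<Longrightarrow>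
      L' (metric \<kappa> h) e F x = L (metric \<kappa> h) e F x"
  shows "finite_sum_of_interaction_terms R L'"
  using assms unfolding finite_sum_of_interaction_terms_def by auto

lemma decomposable_add:
  assumes "finite_sum_of_interaction_terms R L" "finite_sum_of_interaction_terms R L'"
  shows "finite_sum_of_interaction_terms R (\<lambda>g e F x. L g e F x + L' g e F x)"
proof -
  obtain Ls where Ls: "\<forall>l\<in>set Ls. interaction_term l"
    "\<forall>\<kappa> h e F x. graviton_background \<kappa> h e \<longrightarrow> matter_configuration R F \<longrightarrow>
      L (metric \<kappa> h) e F x = (\<Sum>l\<leftarrow>Ls. l (metric \<kappa> h) e F x)"
    using assms(1) unfolding finite_sum_of_interaction_terms_def by blast
  obtain Ls' where Ls': "\<forall>l\<in>set Ls'. interaction_term l"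
    "\<forall>\<kappa> h e F x. graviton_background \<kappa> h e \<longrightarrow> matter_configuration R F \<longrightarrow>
      L' (metric \<kappa> h) e F x = (\<Sum>l\<leftarrow>Ls'. l (metric \<kappa> h) e F x)"
    using assms(2) unfolding finite_sum_of_interaction_terms_def by blast
  show ?thesis
    unfolding finite_sum_of_interaction_terms_def
    by (rule exI[of _ "Ls @ Ls'"]) (use Ls Ls' in auto)
qed

lemma decomposable_sum:
  assumes "\<And>i. i \<in> I \<Longrightarrow> finite_sum_of_interaction_terms R (L i)"
  shows "finite_sum_of_interaction_terms R (\<lambda>g e F x. \<Sum>i\<in>I. L i g e F x)"
  using assms
  by (induction I rule: infinite_finite_induct) (simp_all add: decomposable_zero decomposable_add)

lemma decomposable_case_prod:
  "(\<And>a b. finite_sum_of_interaction_terms R (L a b)) \<Longrightarrow>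
    finite_sum_of_interaction_terms R (\<lambda>g e F x. case p of (a, b) \<Rightarrow> L a b g e F x)"
  by (cases p) simp

lemma decomposable_mult_left:
  assumes "finite_sum_of_interaction_terms R L" "matter_built S"
  shows "finite_sum_of_interaction_terms R (\<lambda>g e F x. S F x * L g e F x)"
proof -
  obtain Ls where Ls: "\<forall>l\<in>set Ls. interaction_term l"
    "\<forall>\<kappa> h e F x. graviton_background \<kappa> h e \<longrightarrow> matter_configuration R F \<longrightarrow>
      L (metric \<kappa> h) e F x = (\<Sum>l\<leftarrow>Ls. l (metric \<kappa> h) e F x)"
    using assms(1) unfolding finite_sum_of_interaction_terms_def by blast
  show ?thesis
    unfolding finite_sum_of_interaction_terms_def
    by (rule exI[of _ "map (\<lambda>l g e F x. S F x * l g e F x) Ls"])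
      (use Ls interaction_term_mult_left[OF _ assms(2)] in \<open>auto simp: sum_list_const_mult o_def\<close>)
qed

text \<open>A complex constant is itself a matter functional, so it is a special case of a left
  factor.\<close>

lemma decomposable_scaleC:
  "finite_sum_of_interaction_terms R L \<Longrightarrow>
    finite_sum_of_interaction_terms R (\<lambda>g e F x. a *\<^sub>C L g e F x)"
  by (subst scaleC_conv_mult) (rule decomposable_mult_left[OF _ const])

lemma decomposable_scaleR:
  "finite_sum_of_interaction_terms R L \<Longrightarrow>
    finite_sum_of_interaction_terms R (\<lambda>g e F x. r *\<^sub>R L g e F x)"
  by (simp add: scaleR_scaleC decomposable_scaleC)

lemma decomposable_diff:
  assumes "finite_sum_of_interaction_terms R L" "finite_sum_of_interaction_terms R L'"
  shows "finite_sum_of_interaction_terms R (\<lambda>g e F x. L g e F x - L' g e F x)"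
  using decomposable_add[OF assms(1) decomposable_scaleR[OF assms(2), of "- 1"]] by simp

text \<open>The introduction rules are listed in the order of the types, so item k is the rule for
  type k.\<close>

lemmas decomposable_types =
  interaction_term.intros[THEN interaction_term_decomposable]

section \<open>Bosonic, ghost and Yukawa densities\<close>

lemma real_scalar_decomposable:
  "finite_sum_of_interaction_terms R (real_scalar_density I \<alpha> s)"
proof -
  have "finite_sum_of_interaction_terms R (\<lambda>g e F x.
      (1 / 2) *\<^sub>R (vol g x *\<^sub>R (\<Sum>(\<mu>, \<nu>)\<in>UNIV. ginv g x \<mu> \<nu> *\<^sub>R
        (pd \<mu> (F (Scalar s)) x * pd \<nu> (F (Scalar s)) x))) +
      vol g x *\<^sub>R (\<Sum>i\<in>I. (\<alpha> i / fact i) *\<^sub>C F (Scalar s) x ^ i))"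
    by (intro decomposable_add decomposable_scaleR decomposable_types(1,2) matter_built_intros)
  then show ?thesis
    by (rule decomposable_cong) (simp add: real_scalar_density_def Let_def scaleR_add_right)
qed

text \<open>On scalars the gauge-covariant derivative involves no Christoffel symbol, so it is a
  matter functional: the kinetic term is of type 2 and the potential of type 1.\<close>

lemma scalar_multiplet_decomposable:
  "finite_sum_of_interaction_terms R (scalar_multiplet_density gc \<bb> A I \<alpha> \<Phi>)"
proof -
  have "finite_sum_of_interaction_terms R (\<lambda>g e F x.
      vol g x *\<^sub>R (\<Sum>(\<mu>, \<nu>)\<in>UNIV. ginv g x \<mu> \<nu> *\<^sub>R (\<Sum>k\<in>UNIV.
        star (pd \<mu> (F (Scalar (\<Phi> k))) x + gauge_action gc \<bb> A F \<mu> (\<lambda>j. F (Scalar (\<Phi> j)) x) k x) *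
        (pd \<nu> (F (Scalar (\<Phi> k))) x + gauge_action gc \<bb> A F \<nu> (\<lambda>j. F (Scalar (\<Phi> j)) x) k x))) +
      vol g x *\<^sub>R (\<Sum>i\<in>I. (\<alpha> i / fact i) *\<^sub>C
        (\<Sum>k\<in>UNIV. star (F (Scalar (\<Phi> k)) x) * F (Scalar (\<Phi> k)) x) ^ i))"
    by (intro decomposable_add decomposable_types(1,2) matter_built_intros matter_built_gauge_action)
  then show ?thesis
    by (rule decomposable_cong) (simp add: scalar_multiplet_density_def Let_def scaleR_add_right)
qed

lemma yukawa_decomposable:
  "finite_sum_of_interaction_terms R (yukawa_density \<gamma> \<alpha>)"
proof -
  \<comment> \<open>For each triple of labels the only gravitational factor besides the volume is
    the vielbein at curved index 0; sign, coupling and scalar field go into the type 7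
    array.\<close>
  have "finite_sum_of_interaction_terms R (\<lambda>g e F x. \<Sum>(s, p, p')\<in>UNIV.
      vol g x *\<^sub>R (\<Sum>b\<in>UNIV. (e x $ b $ 0) *\<^sub>R - (\<alpha> s p p' *\<^sub>C (F (Scalar s) x *
        (\<Sum>\<beta>\<in>UNIV. conj_flat \<gamma> p b F \<beta> x * F (Spinor p' \<beta>) x)))))"
    unfolding sum_UNIV_prod prod.case
    by (intro decomposable_sum decomposable_types(7) matter_built_intros matter_built_conj_flat)
  then show ?thesis
    by (rule decomposable_cong)
      (simp add: yukawa_density_def sum_distrib_left scaleC_sum_right scaleC_scaleR_right
        scaleR_sum_right sum_negf split_def)
qed

text \<open>The field strength is formed from partial derivatives, hence free of gravitons. Type 3
  leaves the index pattern of its array open, so the crossed contraction of the two field strengths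
  fits.\<close>

lemma yang_mills_decomposable:
  "finite_sum_of_interaction_terms R (yang_mills_density gc q f A)"
proof -
  have "finite_sum_of_interaction_terms R (\<lambda>g e F x. (1 / (4 * gc\<^sup>2)) *\<^sub>R (\<Sum>a\<in>UNIV. vol g x *\<^sub>R
      (\<Sum>(\<mu>, \<nu>, \<rho>, \<sigma>)\<in>UNIV. (ginv g x \<mu> \<nu> * ginv g x \<rho> \<sigma>) *\<^sub>R
        (field_strength gc q f A F a \<mu> \<rho> x * field_strength gc q f A F a \<nu> \<sigma> x))))"
    by (intro decomposable_scaleR decomposable_sum decomposable_types(3) mult
        matter_built_field_strength)
  then show ?thesis
    by (rule decomposable_cong) (simp add: yang_mills_density_def scaleR_sum_right mult.commute)
qed

lemma electroweak_ghost_decomposable: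
  "finite_sum_of_interaction_terms R (electroweak_ghost_density J \<xi> m)"
  unfolding electroweak_ghost_density_def[abs_def]
  by (intro decomposable_types(1) matter_built_intros)

section \<open>Traced covariant derivatives and gauge fixing\<close>

text \<open>The two parts of the covariant derivative give types 2 and 4. As
  \<open>matter_built\<close> differentiates single fields only, the derivative of a composite
  covector \<open>V\<close> is supplied separately as a matter functional \<open>dV\<close>.\<close>

lemma cov_trace_decomposable:
  assumes "\<And>\<tau>. matter_built (V \<tau>)" "\<And>\<mu> \<nu>. matter_built (dV \<mu> \<nu>)"
    and "\<And>F x \<mu> \<nu>. matter_configuration R F \<Longrightarrow> pd \<mu> (V \<nu> F) x = dV \<mu> \<nu> F x"
  shows "finite_sum_of_interaction_terms R (\<lambda>g e F x. vol g x *\<^sub>R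
    (\<Sum>(\<mu>, \<nu>)\<in>UNIV. ginv g x \<mu> \<nu> *\<^sub>R cov g \<mu> (\<lambda>\<kappa>. V \<kappa> F) \<nu> x))"
proof -
  have "finite_sum_of_interaction_terms R (\<lambda>g e F x.
      vol g x *\<^sub>R (\<Sum>(\<mu>, \<nu>)\<in>UNIV. ginv g x \<mu> \<nu> *\<^sub>R dV \<mu> \<nu> F x) -
      vol g x *\<^sub>R (\<Sum>(\<mu>, \<nu>, \<tau>)\<in>UNIV. (ginv g x \<mu> \<nu> * christoffel g x \<mu> \<nu> \<tau>) *\<^sub>R V \<tau> F x))"
    by (intro decomposable_diff decomposable_types(2,4) assms(1,2))
  then show ?thesis
    by (rule decomposable_cong)
      (simp add: cov_def assms(3) sum_UNIV_prod scaleR_diff_right scaleR_sum_right sum_subtractf)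
qed

lemma cov_trace_mult_decomposable:
  fixes V W :: "4 \<Rightarrow> ('s, 'f, 'v, 'c, 'z::star_superalgebra) matter \<Rightarrow> spacetime \<Rightarrow> 'z"
  assumes "\<And>\<tau>. matter_built (V \<tau>)" "\<And>\<mu> \<nu>. matter_built (dV \<mu> \<nu>)"
    and "\<And>F x \<mu> \<nu>. matter_configuration R F \<Longrightarrow> pd \<mu> (V \<nu> F) x = dV \<mu> \<nu> F x"
    and "\<And>\<tau>. matter_built (W \<tau>)" "\<And>\<mu> \<nu>. matter_built (dW \<mu> \<nu>)"
    and "\<And>F x \<mu> \<nu>. matter_configuration R F \<Longrightarrow> pd \<mu> (W \<nu> F) x = dW \<mu> \<nu> F x"
  shows "finite_sum_of_interaction_terms R (\<lambda>g e F x. vol g x *\<^sub>R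
    (\<Sum>(\<mu>, \<nu>, \<rho>, \<sigma>)\<in>UNIV. (ginv g x \<mu> \<nu> * ginv g x \<rho> \<sigma>) *\<^sub>R
      (cov g \<mu> (\<lambda>\<kappa>. V \<kappa> F) \<nu> x * cov g \<rho> (\<lambda>\<kappa>. W \<kappa> F) \<sigma> x)))"
proof -
  \<comment> \<open>Multiplying out two covariant derivatives gives the derivative product (type 3),
    two cross terms (type 5) and the product of both Christoffel parts (type 6).\<close>
  have decomposable: "finite_sum_of_interaction_terms R (\<lambda>g e F x.
      vol g x *\<^sub>R (\<Sum>(\<mu>, \<nu>, \<rho>, \<sigma>)\<in>UNIV. (ginv g x \<mu> \<nu> * ginv g x \<rho> \<sigma>) *\<^sub>R
        (dV \<mu> \<nu> F x * dW \<rho> \<sigma> F x)) -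
      vol g x *\<^sub>R (\<Sum>(\<mu>, \<nu>, \<rho>, \<sigma>, \<tau>)\<in>UNIV.
        (ginv g x \<mu> \<nu> * ginv g x \<rho> \<sigma> * christoffel g x \<mu> \<nu> \<tau>) *\<^sub>R (V \<tau> F x * dW \<rho> \<sigma> F x)) -
      vol g x *\<^sub>R (\<Sum>(\<mu>, \<nu>, \<rho>, \<sigma>, \<tau>)\<in>UNIV.
        (ginv g x \<mu> \<nu> * ginv g x \<rho> \<sigma> * christoffel g x \<mu> \<nu> \<tau>) *\<^sub>R (dV \<rho> \<sigma> F x * W \<tau> F x)) +
      vol g x *\<^sub>R (\<Sum>(\<mu>, \<nu>, \<rho>, \<sigma>, \<kappa>, \<tau>)\<in>UNIV.
        (ginv g x \<mu> \<nu> * ginv g x \<rho> \<sigma> * christoffel g x \<mu> \<nu> \<kappa> * christoffel g x \<rho> \<sigma> \<tau>) *\<^sub>R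
          (V \<kappa> F x * W \<tau> F x)))"
    by (intro decomposable_add decomposable_diff decomposable_types(3,5,6) mult assms(1,2,4,5))
  show ?thesis
  proof (rule decomposable_cong[OF decomposable])
    fix \<kappa> h e x and F :: "('s, 'f, 'v, 'c, 'z) matter"
    assume F: "matter_configuration R F"
    let ?g = "metric \<kappa> h"
    \<comment> \<open>Type 5 contracts the Christoffel symbol with the first inverse metric. The
      cross term having it on the second one is brought to this form by exchanging the index
      pairs.\<close>
    have swap: "(\<Sum>(\<mu>, \<nu>, \<rho>, \<sigma>, \<tau>)\<in>UNIV.
        (ginv ?g x \<mu> \<nu> * ginv ?g x \<rho> \<sigma> * christoffel ?g x \<mu> \<nu> \<tau>) *\<^sub>R (dV \<rho> \<sigma> F x * W \<tau> F x)) =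
      (\<Sum>(\<mu>, \<nu>, \<rho>, \<sigma>, \<tau>)\<in>UNIV.
        (ginv ?g x \<mu> \<nu> * ginv ?g x \<rho> \<sigma> * christoffel ?g x \<rho> \<sigma> \<tau>) *\<^sub>R (dV \<mu> \<nu> F x * W \<tau> F x))"
      by (rule sum.reindex_bij_witness[of _ "\<lambda>(\<mu>, \<nu>, \<rho>, \<sigma>, \<tau>). (\<rho>, \<sigma>, \<mu>, \<nu>, \<tau>)"
            "\<lambda>(\<mu>, \<nu>, \<rho>, \<sigma>, \<tau>). (\<rho>, \<sigma>, \<mu>, \<nu>, \<tau>)"]) (auto simp: mult.commute)
    show "vol ?g x *\<^sub>R (\<Sum>(\<mu>, \<nu>, \<rho>, \<sigma>)\<in>UNIV. (ginv ?g x \<mu> \<nu> * ginv ?g x \<rho> \<sigma>) *\<^sub>R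
        (cov ?g \<mu> (\<lambda>\<kappa>. V \<kappa> F) \<nu> x * cov ?g \<rho> (\<lambda>\<kappa>. W \<kappa> F) \<sigma> x)) =
      vol ?g x *\<^sub>R (\<Sum>(\<mu>, \<nu>, \<rho>, \<sigma>)\<in>UNIV. (ginv ?g x \<mu> \<nu> * ginv ?g x \<rho> \<sigma>) *\<^sub>R
        (dV \<mu> \<nu> F x * dW \<rho> \<sigma> F x)) -
      vol ?g x *\<^sub>R (\<Sum>(\<mu>, \<nu>, \<rho>, \<sigma>, \<tau>)\<in>UNIV.
        (ginv ?g x \<mu> \<nu> * ginv ?g x \<rho> \<sigma> * christoffel ?g x \<mu> \<nu> \<tau>) *\<^sub>R (V \<tau> F x * dW \<rho> \<sigma> F x)) -
      vol ?g x *\<^sub>R (\<Sum>(\<mu>, \<nu>, \<rho>, \<sigma>, \<tau>)\<in>UNIV.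
        (ginv ?g x \<mu> \<nu> * ginv ?g x \<rho> \<sigma> * christoffel ?g x \<mu> \<nu> \<tau>) *\<^sub>R (dV \<rho> \<sigma> F x * W \<tau> F x)) +
      vol ?g x *\<^sub>R (\<Sum>(\<mu>, \<nu>, \<rho>, \<sigma>, \<kappa>, \<tau>)\<in>UNIV.
        (ginv ?g x \<mu> \<nu> * ginv ?g x \<rho> \<sigma> * christoffel ?g x \<mu> \<nu> \<kappa> * christoffel ?g x \<rho> \<sigma> \<tau>) *\<^sub>R
          (V \<kappa> F x * W \<tau> F x))"
      \<comment> \<open>After expansion, only the order of the two inner sums of the type 6 term
        remains to be interchanged.\<close>
      unfolding swap
      by (simp add: cov_def assms(3,6)[OF F] sum_UNIV_prod left_diff_distrib right_diff_distrib
          sum_product sum_distrib_left sum_distrib_right scaleR_diff_right scaleR_sum_right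
          sum_subtractf mult.assoc)
        (rule sum.cong[OF refl], rule sum.cong[OF refl], rule sum.cong[OF refl],
          rule sum.cong[OF refl], rule trans[OF sum.swap], simp add: mult.commute)
  qed
qed

text \<open>Two vector fields are allowed so that the mixed \<open>Wm\<close>, \<open>Wp\<close>
  term is covered along with the squares in the Lorenz and Z cases.\<close>

lemma gauge_fixing_decomposable:
  "finite_sum_of_interaction_terms R (\<lambda>g e F x. vol g x *\<^sub>R
    (\<Sum>(\<mu>, \<nu>, \<rho>, \<sigma>)\<in>UNIV. (ginv g x \<mu> \<nu> * ginv g x \<rho> \<sigma>) *\<^sub>R
      (cov g \<mu> (\<lambda>\<kappa>. F (Vector V \<kappa>)) \<nu> x * cov g \<rho> (\<lambda>\<kappa>. F (Vector W \<kappa>)) \<sigma> x)))"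
  by (rule cov_trace_mult_decomposable[where dV = "\<lambda>\<mu> \<nu> F. pd \<mu> (F (Vector V \<nu>))"
        and dW = "\<lambda>\<mu> \<nu> F. pd \<mu> (F (Vector W \<nu>))"])
    (intro matter_built_intros refl)+

lemma vector_divergence_decomposable:
  "finite_sum_of_interaction_terms R (\<lambda>g e F x. vol g x *\<^sub>R
    (\<Sum>(\<mu>, \<nu>)\<in>UNIV. ginv g x \<mu> \<nu> *\<^sub>R cov g \<mu> (\<lambda>\<kappa>. F (Vector V \<kappa>)) \<nu> x))"
  by (rule cov_trace_decomposable[where dV = "\<lambda>\<mu> \<nu> F. pd \<mu> (F (Vector V \<nu>))"])
    (intro matter_built_intros refl)+

lemma lorenz_gauge_decomposable:
  "finite_sum_of_interaction_terms R (lorenz_gauge_density \<xi> A)"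
proof -
  have "finite_sum_of_interaction_terms R (\<lambda>g e F x. (1 / (2 * \<xi>)) *\<^sub>R (\<Sum>a\<in>UNIV. vol g x *\<^sub>R
      (\<Sum>(\<mu>, \<nu>, \<rho>, \<sigma>)\<in>UNIV. (ginv g x \<mu> \<nu> * ginv g x \<rho> \<sigma>) *\<^sub>R
        (cov g \<mu> (\<lambda>\<kappa>. F (Vector (A a) \<kappa>)) \<nu> x * cov g \<rho> (\<lambda>\<kappa>. F (Vector (A a) \<kappa>)) \<sigma> x))))"
    by (intro decomposable_scaleR decomposable_sum gauge_fixing_decomposable)
  then show ?thesis
    by (rule decomposable_cong) (simp add: lorenz_gauge_density_def scaleR_sum_right mult.commute)
qed

text \<open>The mixing term is the Goldstone field times a divergence, so it keeps the types 2 and 4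
  of the divergence; the Goldstone mass term is of type 1.\<close>

lemma Z_gauge_decomposable:
  "finite_sum_of_interaction_terms R (Z_gauge_density \<xi> m Z \<phi>Z)"
proof -
  have "finite_sum_of_interaction_terms R (\<lambda>g e F x.
      (1 / (2 * \<xi>)) *\<^sub>R (vol g x *\<^sub>R (\<Sum>(\<mu>, \<nu>, \<rho>, \<sigma>)\<in>UNIV. (ginv g x \<mu> \<nu> * ginv g x \<rho> \<sigma>) *\<^sub>R
        (cov g \<mu> (\<lambda>\<kappa>. F (Vector Z \<kappa>)) \<nu> x * cov g \<rho> (\<lambda>\<kappa>. F (Vector Z \<kappa>)) \<sigma> x))) +
      m *\<^sub>R (F (Scalar \<phi>Z) x * (vol g x *\<^sub>R (\<Sum>(\<mu>, \<nu>)\<in>UNIV. ginv g x \<mu> \<nu> *\<^sub>R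
        cov g \<mu> (\<lambda>\<kappa>. F (Vector Z \<kappa>)) \<nu> x))) +
      vol g x *\<^sub>R ((\<xi> / 2 * m\<^sup>2) *\<^sub>R (F (Scalar \<phi>Z) x)\<^sup>2))"
    by (intro decomposable_add decomposable_scaleR decomposable_mult_left decomposable_types(1)
        gauge_fixing_decomposable vector_divergence_decomposable matter_built_intros)
  then show ?thesis
    by (rule decomposable_cong)
      (simp add: Z_gauge_density_def Let_def scaleR_add_right mult.commute)
qed

lemma W_gauge_decomposable:
  "finite_sum_of_interaction_terms R (W_gauge_density \<xi> m Wp Wm \<phi>Wp \<phi>Wm)"
proof -
  have "finite_sum_of_interaction_terms R (\<lambda>g e F x.
      (1 / \<xi>) *\<^sub>R (vol g x *\<^sub>R (\<Sum>(\<mu>, \<nu>, \<rho>, \<sigma>)\<in>UNIV. (ginv g x \<mu> \<nu> * ginv g x \<rho> \<sigma>) *\<^sub>R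
        (cov g \<mu> (\<lambda>\<kappa>. F (Vector Wm \<kappa>)) \<nu> x * cov g \<rho> (\<lambda>\<kappa>. F (Vector Wp \<kappa>)) \<sigma> x))) +
      vol g x *\<^sub>R ((\<xi> * m\<^sup>2) *\<^sub>R (F (Scalar \<phi>Wm) x * F (Scalar \<phi>Wp) x)) +
      (\<i> * m) *\<^sub>C
        (F (Scalar \<phi>Wp) x * (vol g x *\<^sub>R (\<Sum>(\<mu>, \<nu>)\<in>UNIV. ginv g x \<mu> \<nu> *\<^sub>R
          cov g \<mu> (\<lambda>\<kappa>. F (Vector Wm \<kappa>)) \<nu> x)) -
        F (Scalar \<phi>Wm) x * (vol g x *\<^sub>R (\<Sum>(\<mu>, \<nu>)\<in>UNIV. ginv g x \<mu> \<nu> *\<^sub>R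
          cov g \<mu> (\<lambda>\<kappa>. F (Vector Wp \<kappa>)) \<nu> x))))"
    by (intro decomposable_add decomposable_diff decomposable_scaleR decomposable_scaleC
        decomposable_mult_left decomposable_types(1) gauge_fixing_decomposable
        vector_divergence_decomposable matter_built_intros)
  then show ?thesis
    by (rule decomposable_cong)
      (simp add: W_gauge_density_def Let_def scaleR_add_right scaleR_diff_right mult.commute
        sum_distrib_left sum_subtractf split_def flip: scaleC_scaleR_right)
qed

section \<open>Gauge ghosts\<close>

lemma matter_differentiable: "matter_configuration R F \<Longrightarrow> F l differentiable at x"
  by (simp add: matter_configuration_def smooth_differentiable)

lemma gauge_ghost_decomposable:
  "finite_sum_of_interaction_terms R (gauge_ghost_density gc f A c)"
proof -
  \<comment> \<open>The covector is the gradient of a ghost, so its derivative consists of second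
    partial derivatives of a field.\<close>
  have ghost: "finite_sum_of_interaction_terms R (\<lambda>g e F x. vol g x *\<^sub>R
      (\<Sum>(\<mu>, \<nu>)\<in>UNIV. ginv g x \<mu> \<nu> *\<^sub>R cov g \<mu> (\<lambda>\<kappa>. pd \<kappa> (F (Ghost w))) \<nu> x))" for w
    by (rule cov_trace_decomposable[where dV = "\<lambda>\<mu> \<nu> F. pd \<mu> (pd \<nu> (F (Ghost w)))"])
      (intro matter_built_intros refl)+
  \<comment> \<open>Here the covector is a product of fields; the Leibniz rule, valid by smoothness
    of the configuration, provides \<open>dV\<close>.\<close>
  have gauge_ghost: "finite_sum_of_interaction_terms R (\<lambda>g e F x. vol g x *\<^sub>R
      (\<Sum>(\<mu>, \<nu>)\<in>UNIV. ginv g x \<mu> \<nu> *\<^sub>R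
        cov g \<mu> (\<lambda>\<kappa> y. F (Vector v \<kappa>) y * F (Ghost w) y) \<nu> x))" for v w
    by (rule cov_trace_decomposable[where dV = "\<lambda>\<mu> \<nu> F x.
          pd \<mu> (F (Vector v \<nu>)) x * F (Ghost w) x + F (Vector v \<nu>) x * pd \<mu> (F (Ghost w)) x"])
      (intro matter_built_intros | simp add: pd_mult matter_differentiable)+
  \<comment> \<open>The gauge sums are taken outside, which leaves each antighost as a left factor
    of a trace already decomposed; interchanging spacetime and gauge sums recovers the
    density.\<close>
  have "finite_sum_of_interaction_terms R (\<lambda>g e F x.
      (\<Sum>a\<in>UNIV. F (Antighost (c a)) x * (vol g x *\<^sub>R (\<Sum>(\<mu>, \<nu>)\<in>UNIV. ginv g x \<mu> \<nu> *\<^sub>R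
        cov g \<mu> (\<lambda>\<kappa>. pd \<kappa> (F (Ghost (c a)))) \<nu> x))) +
      (\<i> * gc) *\<^sub>C (\<Sum>(a, b, d)\<in>UNIV. f a b d *\<^sub>C (F (Antighost (c a)) x *
        (vol g x *\<^sub>R (\<Sum>(\<mu>, \<nu>)\<in>UNIV. ginv g x \<mu> \<nu> *\<^sub>R
          cov g \<mu> (\<lambda>\<kappa> y. F (Vector (A b) \<kappa>) y * F (Ghost (c d)) y) \<nu> x)))))"
    by (intro decomposable_add decomposable_scaleC decomposable_sum decomposable_case_prod
        decomposable_mult_left matter_built_intros ghost gauge_ghost)
  then show ?thesis
    by (rule decomposable_cong)
      (simp add: gauge_ghost_density_def scaleR_add_right scaleR_sum_right sum_distrib_left
        scaleC_sum_right scaleC_scaleR_right split_def,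
       intro arg_cong2[where f = "(+)"] sum.swap)
qed

section \<open>Spinor densities\<close>

text \<open>The part of the Dirac bilinear left after removing both vielbein factors:
  \<open>b\<close> is the flat index of the Dirac conjugate, \<open>r\<close> that of the Dirac
  operator.\<close>

definition flat_bilinear ::
  "(4 \<Rightarrow> complex ^ 4 ^ 4) \<Rightarrow> 'f \<Rightarrow> ('s, 'f, 'v, 'c, 'z::star_superalgebra) matter \<Rightarrow> spacetime \<Rightarrow>
    4 \<Rightarrow> 4 \<Rightarrow> (4 \<Rightarrow> 'z) \<Rightarrow> 'z" where
  "flat_bilinear \<gamma> p F x b r X =
    (\<Sum>\<alpha>\<in>UNIV. \<Sum>\<beta>\<in>UNIV. conj_flat \<gamma> p b F \<alpha> x * ((\<i> * \<gamma> r $ \<alpha> $ \<beta>) *\<^sub>C X \<beta>))"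

text \<open>The action of the spin connection on the spinor with the coefficient
  \<open>omega\<close> stripped off.\<close>

definition spin_action ::
  "(4 \<Rightarrow> complex ^ 4 ^ 4) \<Rightarrow> 'f \<Rightarrow> ('s, 'f, 'v, 'c, 'z::star_superalgebra) matter \<Rightarrow> spacetime \<Rightarrow>
    4 \<Rightarrow> 4 \<Rightarrow> 4 \<Rightarrow> 'z" where
  "spin_action \<gamma> p F x s t \<beta> =
    (\<Sum>\<delta>\<in>UNIV. (- (\<i> / 4) * sigma \<gamma> s t $ \<beta> $ \<delta>) *\<^sub>C F (Spinor p \<delta>) x)"

lemma matter_built_flat_bilinear:
  "(\<And>\<beta>. matter_built (X \<beta>)) \<Longrightarrow>
    matter_built (\<lambda>F x. flat_bilinear \<gamma> p F x b r (\<lambda>\<beta>. X \<beta> F x))"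
  unfolding flat_bilinear_def by (intro matter_built_intros matter_built_conj_flat)

lemma matter_built_spin_action: "matter_built (\<lambda>F x. spin_action \<gamma> p F x s t \<beta>)"
  unfolding spin_action_def by (intro matter_built_intros)

lemma flat_bilinear_add:
  "flat_bilinear \<gamma> p F x b r (\<lambda>\<beta>. X \<beta> + Y \<beta>) =
    flat_bilinear \<gamma> p F x b r X + flat_bilinear \<gamma> p F x b r Y"
  by (simp add: flat_bilinear_def scaleC_add_right distrib_left sum.distrib)

lemma flat_bilinear_scaleR:
  "flat_bilinear \<gamma> p F x b r (\<lambda>\<beta>. c *\<^sub>R X \<beta>) = c *\<^sub>R flat_bilinear \<gamma> p F x b r X"
  by (simp add: flat_bilinear_def scaleC_scaleR_right scaleR_sum_right)

lemma flat_bilinear_sum: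
  "flat_bilinear \<gamma> p F x b r (\<lambda>\<beta>. \<Sum>i\<in>I. X i \<beta>) = (\<Sum>i\<in>I. flat_bilinear \<gamma> p F x b r (X i))"
proof -
  have zero: "flat_bilinear \<gamma> p F x b r (\<lambda>\<beta>. 0) = 0"
    using flat_bilinear_scaleR[of \<gamma> p F x b r 0 "\<lambda>\<beta>. 0"] by simp
  show ?thesis
    by (induction I rule: infinite_finite_induct) (simp_all add: zero flat_bilinear_add)
qed

text \<open>The vielbein components are real and independent of the spinor indices, so they can be
  pulled out of the bilinear. The coefficient is that of type 8; for \<open>X\<close> containing
  \<open>omega\<close> it is the common factor of types 9 and 10.\<close>

lemma dirac_conj_slash:
  "(\<Sum>\<alpha>\<in>UNIV. dirac_conj \<gamma> p e F \<alpha> x * dirac_slash \<gamma> e x X \<alpha>) =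
    (\<Sum>b\<in>UNIV. \<Sum>\<rho>\<in>UNIV. \<Sum>r\<in>UNIV. (e x $ b $ 0 * vup e x \<rho> r) *\<^sub>R flat_bilinear \<gamma> p F x b r (X \<rho>))"
proof -
  have "(\<Sum>\<alpha>\<in>UNIV. dirac_conj \<gamma> p e F \<alpha> x * dirac_slash \<gamma> e x X \<alpha>) =
    (\<Sum>\<alpha>\<in>UNIV. \<Sum>b\<in>UNIV. \<Sum>\<rho>\<in>UNIV. \<Sum>r\<in>UNIV. (e x $ b $ 0 * vup e x \<rho> r) *\<^sub>R
      (\<Sum>\<beta>\<in>UNIV. conj_flat \<gamma> p b F \<alpha> x * ((\<i> * \<gamma> r $ \<alpha> $ \<beta>) *\<^sub>C X \<rho> \<beta>)))"
    unfolding dirac_conj_def sum_distrib_right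
    by (simp add: dirac_slash_def sum_UNIV_prod scaleR_sum_right sum_distrib_left mult.commute)
  also have "\<dots> = (\<Sum>b\<in>UNIV. \<Sum>\<rho>\<in>UNIV. \<Sum>r\<in>UNIV. \<Sum>\<alpha>\<in>UNIV. (e x $ b $ 0 * vup e x \<rho> r) *\<^sub>R
      (\<Sum>\<beta>\<in>UNIV. conj_flat \<gamma> p b F \<alpha> x * ((\<i> * \<gamma> r $ \<alpha> $ \<beta>) *\<^sub>C X \<rho> \<beta>)))"
    by (rule trans[OF sum.swap], rule sum.cong[OF refl], rule trans[OF sum.swap],
        rule sum.cong[OF refl], rule sum.swap)
  finally show ?thesis
    by (simp add: flat_bilinear_def scaleR_sum_right)
qed

text \<open>The connection is linear in the real numbers \<open>omega\<close>, with constant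
  matrices as coefficients; in this form linearity of \<open>flat_bilinear\<close> applies.\<close>

lemma spin_derivative_eq:
  "spin_derivative \<gamma> p g e F \<mu> \<beta> x = pd \<mu> (F (Spinor p \<beta>)) x +
    (\<Sum>s\<in>UNIV. \<Sum>t\<in>UNIV. omega g e x \<mu> s t *\<^sub>R spin_action \<gamma> p F x s t \<beta>)"
proof -
  have "(\<Sum>\<delta>\<in>UNIV. spin_connection \<gamma> g e x \<mu> $ \<beta> $ \<delta> *\<^sub>C F (Spinor p \<delta>) x) =
    (\<Sum>\<delta>\<in>UNIV. \<Sum>s\<in>UNIV. \<Sum>t\<in>UNIV. omega g e x \<mu> s t *\<^sub>R
      ((- (\<i> / 4) * sigma \<gamma> s t $ \<beta> $ \<delta>) *\<^sub>C F (Spinor p \<delta>) x))"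
    by (simp add: spin_connection_def sum_UNIV_prod sum_distrib_left scaleC_sum_left
        scaleR_scaleC scaleC_scaleC mult_ac del: mult_minus_left mult_minus_right)
  also have "\<dots> = (\<Sum>s\<in>UNIV. \<Sum>t\<in>UNIV. \<Sum>\<delta>\<in>UNIV. omega g e x \<mu> s t *\<^sub>R
      ((- (\<i> / 4) * sigma \<gamma> s t $ \<beta> $ \<delta>) *\<^sub>C F (Spinor p \<delta>) x))"
    by (rule trans[OF sum.swap], rule sum.cong[OF refl], rule sum.swap)
  finally show ?thesis
    by (simp add: spin_derivative_def spin_action_def scaleR_sum_right)
qed

text \<open>Brings the sums of the vielbein-derivative part of \<open>omega\<close> into the index
  order of type 9.\<close>

lemma sum_rev3:
  "(\<Sum>a\<in>A. \<Sum>b\<in>B. \<Sum>c\<in>C. u a b c) = (\<Sum>c\<in>C. \<Sum>b\<in>B. \<Sum>a\<in>A. u a b c)"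
proof -
  have "(\<Sum>a\<in>A. \<Sum>b\<in>B. \<Sum>c\<in>C. u a b c) = (\<Sum>a\<in>A. \<Sum>c\<in>C. \<Sum>b\<in>B. u a b c)"
    by (rule sum.cong[OF refl], rule sum.swap)
  also have "\<dots> = (\<Sum>c\<in>C. \<Sum>a\<in>A. \<Sum>b\<in>B. u a b c)"
    by (rule sum.swap)
  also have "\<dots> = (\<Sum>c\<in>C. \<Sum>b\<in>B. \<Sum>a\<in>A. u a b c)"
    by (rule sum.cong[OF refl], rule sum.swap)
  finally show ?thesis .
qed

text \<open>Does the same for the Christoffel part and type 10.\<close>

lemma sum_swap_outer4:
  "(\<Sum>a\<in>A. \<Sum>b\<in>B. \<Sum>c\<in>C. \<Sum>d\<in>D. u a b c d) = (\<Sum>d\<in>D. \<Sum>b\<in>B. \<Sum>c\<in>C. \<Sum>a\<in>A. u a b c d)"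
proof -
  have "(\<Sum>a\<in>A. \<Sum>b\<in>B. \<Sum>c\<in>C. \<Sum>d\<in>D. u a b c d) = (\<Sum>d\<in>D. \<Sum>c\<in>C. \<Sum>b\<in>B. \<Sum>a\<in>A. u a b c d)"
    by (subst sum_rev3) (subst sum_rev3[of _ A], subst sum.swap, simp add: sum.swap[of _ A])
  then show ?thesis
    by (simp add: sum.swap[of _ B])
qed

section \<open>The Dirac Lagrangian\<close>

text \<open>The graviton-free addition \<open>G\<close> to the spin derivative treats both spinor
  densities at once: it is 0 for a single spinor and the gauge term for a multiplet.\<close>

lemma dirac_decomposable:
  fixes G :: "4 \<Rightarrow> 4 \<Rightarrow> ('s, 'f, 'v, 'c, 'z::star_superalgebra) matter \<Rightarrow> spacetime \<Rightarrow> 'z"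
  assumes G: "\<And>\<mu> \<beta>. matter_built (G \<mu> \<beta>)"
  shows "finite_sum_of_interaction_terms R (\<lambda>g e F x. vol g x *\<^sub>R
    (\<Sum>\<alpha>\<in>UNIV. dirac_conj \<gamma> p e F \<alpha> x *
      (dirac_slash \<gamma> e x (\<lambda>\<mu> \<beta>. spin_derivative \<gamma> p g e F \<mu> \<beta> x + G \<mu> \<beta> F x) \<alpha> -
        m *\<^sub>R F (Spinor p \<alpha>) x)))"
proof -
  let ?P = "\<lambda>F x. flat_bilinear \<gamma> p F x"
  let ?T8 = "\<lambda>b \<rho> r F x. ?P F x b r (\<lambda>\<beta>. pd \<rho> (F (Spinor p \<beta>)) x + G \<rho> \<beta> F x)"
  \<comment> \<open>In types 9 and 10 the index \<open>s\<close> sits on the inverse vielbein and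
    \<open>t\<close> on the vielbein, the reverse of \<open>omega\<close>; hence the arguments
    \<open>t s\<close>. The same array with opposite sign serves type 9.\<close>
  let ?T10 = "\<lambda>b r s t F x. ?P F x b r (\<lambda>\<beta>. spin_action \<gamma> p F x t s \<beta>)"
  let ?T7 = "\<lambda>b F x. - (\<Sum>\<alpha>\<in>UNIV. conj_flat \<gamma> p b F \<alpha> x * (m *\<^sub>R F (Spinor p \<alpha>) x))"
  have decomposable: "finite_sum_of_interaction_terms R (\<lambda>g e F x.
      vol g x *\<^sub>R (\<Sum>(b, \<rho>, r)\<in>UNIV. (e x $ b $ 0 * vup e x \<rho> r) *\<^sub>R ?T8 b \<rho> r F x) +
      vol g x *\<^sub>R (\<Sum>(b, \<rho>, r, \<sigma>, s, \<tau>, t)\<in>UNIV. (e x $ b $ 0 * vup e x \<rho> r * vup e x \<sigma> s *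
        e x $ t $ \<tau> * christoffel g x \<rho> \<sigma> \<tau>) *\<^sub>R ?T10 b r s t F x) +
      vol g x *\<^sub>R (\<Sum>(b, \<rho>, r, \<sigma>, s, t)\<in>UNIV. (e x $ b $ 0 * vup e x \<rho> r * vup e x \<sigma> s *
        pd \<rho> (\<lambda>y. e y $ t $ \<sigma>) x) *\<^sub>R - ?T10 b r s t F x) +
      vol g x *\<^sub>R (\<Sum>b\<in>UNIV. (e x $ b $ 0) *\<^sub>R ?T7 b F x))"
    by (intro decomposable_add decomposable_types(7-10) matter_built_flat_bilinear
        matter_built_spin_action matter_built_conj_flat matter_built_intros G)
  show ?thesis
  proof (rule decomposable_cong[OF decomposable])
    fix \<kappa> h e x and F :: "('s, 'f, 'v, 'c, 'z) matter"
    assume bg: "graviton_background \<kappa> h e"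
    let ?g = "metric \<kappa> h"
    let ?C = "\<lambda>b \<rho> r. e x $ b $ 0 * vup e x \<rho> r"
    let ?Q = "\<lambda>b r s t. ?P F x b r (spin_action \<gamma> p F x s t)"
    \<comment> \<open>Inserting \<open>omega_eq\<close> splits the connection into its Christoffel
      part and, with a minus sign, its vielbein-derivative part; the sums are then
      reordered.\<close>
    have connection: "(\<Sum>s\<in>UNIV. \<Sum>t\<in>UNIV. omega ?g e x \<rho> s t *\<^sub>R ?Q b r s t) =
        (\<Sum>\<sigma>\<in>UNIV. \<Sum>s\<in>UNIV. \<Sum>\<tau>\<in>UNIV. \<Sum>t\<in>UNIV.
          (vup e x \<sigma> s * e x $ t $ \<tau> * christoffel ?g x \<rho> \<sigma> \<tau>) *\<^sub>R ?Q b r t s) +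
        (\<Sum>\<sigma>\<in>UNIV. \<Sum>s\<in>UNIV. \<Sum>t\<in>UNIV.
          (vup e x \<sigma> s * pd \<rho> (\<lambda>y. e y $ t $ \<sigma>) x) *\<^sub>R - ?Q b r t s)" for b r \<rho>
    proof -
      have "(\<Sum>s\<in>UNIV. \<Sum>t\<in>UNIV. omega ?g e x \<rho> s t *\<^sub>R ?Q b r s t) =
        (\<Sum>t\<in>UNIV. \<Sum>s\<in>UNIV. \<Sum>\<tau>\<in>UNIV. \<Sum>\<sigma>\<in>UNIV.
          (vup e x \<sigma> s * e x $ t $ \<tau> * christoffel ?g x \<rho> \<sigma> \<tau>) *\<^sub>R ?Q b r t s) +
        (\<Sum>t\<in>UNIV. \<Sum>s\<in>UNIV. \<Sum>\<sigma>\<in>UNIV.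
          (vup e x \<sigma> s * pd \<rho> (\<lambda>y. e y $ t $ \<sigma>) x) *\<^sub>R - ?Q b r t s)"
        by (simp add: omega_eq[OF bg] scaleR_diff_left scaleR_sum_left sum_subtractf sum_negf
            mult.commute mult.left_commute)
      then show ?thesis
        by (rule trans) (intro arg_cong2[where f = "(+)"] sum_swap_outer4 sum_rev3)
    qed
    \<comment> \<open>By linearity the partial derivative and \<open>G\<close> form the type 8
      array, while the terms with \<open>omega\<close> are left for
      \<open>connection\<close>.\<close>
    have "(\<Sum>\<alpha>\<in>UNIV. dirac_conj \<gamma> p e F \<alpha> x *
        dirac_slash \<gamma> e x (\<lambda>\<mu> \<beta>. spin_derivative \<gamma> p ?g e F \<mu> \<beta> x + G \<mu> \<beta> F x) \<alpha>) =
      (\<Sum>b\<in>UNIV. \<Sum>\<rho>\<in>UNIV. \<Sum>r\<in>UNIV. ?C b \<rho> r *\<^sub>R (?T8 b \<rho> r F x +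
        (\<Sum>s\<in>UNIV. \<Sum>t\<in>UNIV. omega ?g e x \<rho> s t *\<^sub>R ?Q b r s t)))"
      unfolding dirac_conj_slash spin_derivative_eq
      by (simp add: flat_bilinear_add flat_bilinear_sum flat_bilinear_scaleR add_ac)
    \<comment> \<open>The mass term contains no Dirac operator, so a single vielbein factor remains
      and the term is of type 7.\<close>
    moreover have "(\<Sum>\<alpha>\<in>UNIV. dirac_conj \<gamma> p e F \<alpha> x * (m *\<^sub>R F (Spinor p \<alpha>) x)) =
        - (\<Sum>b\<in>UNIV. (e x $ b $ 0) *\<^sub>R ?T7 b F x)"
      unfolding dirac_conj_def sum_distrib_right
      by (subst sum.swap) (simp add: sum_negf scaleR_sum_right mult.commute)
    ultimately show "vol ?g x *\<^sub>R (\<Sum>\<alpha>\<in>UNIV. dirac_conj \<gamma> p e F \<alpha> x *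
        (dirac_slash \<gamma> e x (\<lambda>\<mu> \<beta>. spin_derivative \<gamma> p ?g e F \<mu> \<beta> x + G \<mu> \<beta> F x) \<alpha> -
          m *\<^sub>R F (Spinor p \<alpha>) x)) =
      vol ?g x *\<^sub>R (\<Sum>(b, \<rho>, r)\<in>UNIV. (e x $ b $ 0 * vup e x \<rho> r) *\<^sub>R ?T8 b \<rho> r F x) +
      vol ?g x *\<^sub>R (\<Sum>(b, \<rho>, r, \<sigma>, s, \<tau>, t)\<in>UNIV. (e x $ b $ 0 * vup e x \<rho> r * vup e x \<sigma> s *
        e x $ t $ \<tau> * christoffel ?g x \<rho> \<sigma> \<tau>) *\<^sub>R ?T10 b r s t F x) +
      vol ?g x *\<^sub>R (\<Sum>(b, \<rho>, r, \<sigma>, s, t)\<in>UNIV. (e x $ b $ 0 * vup e x \<rho> r * vup e x \<sigma> s *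
        pd \<rho> (\<lambda>y. e y $ t $ \<sigma>) x) *\<^sub>R - ?T10 b r s t F x) +
      vol ?g x *\<^sub>R (\<Sum>b\<in>UNIV. (e x $ b $ 0) *\<^sub>R ?T7 b F x)"
      by (simp add: right_diff_distrib sum_subtractf connection sum_UNIV_prod scaleR_add_right
          sum.distrib scaleR_sum_right mult.assoc)
  qed
qed

lemma spinor_decomposable:
  "finite_sum_of_interaction_terms R (spinor_density \<gamma> m p)"
  by (rule decomposable_cong[OF dirac_decomposable[where G = "\<lambda>\<mu> \<beta> F x. 0" and \<gamma> = \<gamma>
          and p = p and m = m, OF matter_built_zero]])
    (simp add: spinor_density_def)

text \<open>The spin connection and the diagonal mass matrix do not mix components. Each component
  is thus a Dirac density of its own, with the coupling to the others contained in
  \<open>G\<close>.\<close>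

lemma spinor_multiplet_decomposable:
  "finite_sum_of_interaction_terms R (spinor_multiplet_density \<gamma> gc \<bb> A m \<Psi>)"
proof -
  have "finite_sum_of_interaction_terms R (\<lambda>g e F x. \<Sum>k\<in>UNIV. vol g x *\<^sub>R
    (\<Sum>\<alpha>\<in>UNIV. dirac_conj \<gamma> (\<Psi> k) e F \<alpha> x * (dirac_slash \<gamma> e x (\<lambda>\<mu> \<beta>. spin_derivative \<gamma> (\<Psi> k) g e F \<mu> \<beta> x +
      gauge_action gc \<bb> A F \<mu> (\<lambda>j. F (Spinor (\<Psi> j) \<beta>) x) k x) \<alpha> - m k *\<^sub>R F (Spinor (\<Psi> k) \<alpha>) x)))"
    by (intro decomposable_sum dirac_decomposable matter_built_gauge_action matter_built_field)
  then show ?thesis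
    by (rule decomposable_cong)
      (simp add: spinor_multiplet_density_def Let_def sum_UNIV_prod scaleR_sum_right)
qed

theorem lemma4p9:
  fixes \<gamma> :: "4 \<Rightarrow> complex ^ 4 ^ 4"
    and gc \<xi> m\<^sub>\<psi> \<xi>\<^sub>Z m\<^sub>Z \<xi>\<^sub>W m\<^sub>W :: real
    and q :: complex
    and f :: "'a::finite \<Rightarrow> 'a \<Rightarrow> 'a \<Rightarrow> complex"
    and \<bb>\<^sub>\<Phi> :: "'a \<Rightarrow> complex ^ 'k ^ 'k::finite"
    and \<bb>\<^sub>\<Psi> :: "'a \<Rightarrow> complex ^ 'm ^ 'm::finite"
    and A :: "'a \<Rightarrow> 'v::finite"
    and c :: "'a \<Rightarrow> 'c::finite"
    and R :: "'s::finite set"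
    and \<phi> \<phi>\<^sub>Z \<phi>\<^sub>W\<^sub>p \<phi>\<^sub>W\<^sub>m :: 's
    and \<Phi> :: "'k \<Rightarrow> 's"
    and \<psi> :: "'f::finite"
    and \<Psi> :: "'m \<Rightarrow> 'f"
    and m\<^sub>\<Psi> :: "'m \<Rightarrow> real"
    and Z W\<^sub>p W\<^sub>m :: 'v
    and I\<^sub>\<phi> I\<^sub>\<Phi> :: "nat set"
    and \<alpha>\<^sub>\<phi> \<alpha>\<^sub>\<Phi> :: "nat \<Rightarrow> complex"
    and \<alpha>\<^sub>Y :: "'s \<Rightarrow> 'f \<Rightarrow> 'f \<Rightarrow> complex"
    and J :: "('s \<times> 'c \<times> 'c) set"
    and \<xi>\<^sub>c m\<^sub>c :: "'c \<Rightarrow> real"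
  assumes "clifford \<gamma>"
    and "structure_constants f" "represents f \<bb>\<^sub>\<Phi>" "represents f \<bb>\<^sub>\<Psi>"
    and "gc \<noteq> 0" "\<xi> \<noteq> 0" "\<xi>\<^sub>Z \<noteq> 0" "\<xi>\<^sub>W \<noteq> 0"
    and "finite I\<^sub>\<phi>" "finite I\<^sub>\<Phi>"
    and "\<phi> \<in> R"
  shows "\<forall>L \<in> {real_scalar_density I\<^sub>\<phi> \<alpha>\<^sub>\<phi> \<phi>,
      scalar_multiplet_density gc \<bb>\<^sub>\<Phi> A I\<^sub>\<Phi> \<alpha>\<^sub>\<Phi> \<Phi>,
      spinor_density \<gamma> m\<^sub>\<psi> \<psi>,
      spinor_multiplet_density \<gamma> gc \<bb>\<^sub>\<Psi> A m\<^sub>\<Psi> \<Psi>,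
      yukawa_density \<gamma> \<alpha>\<^sub>Y,
      yang_mills_density gc q f A,
      lorenz_gauge_density \<xi> A,
      Z_gauge_density \<xi>\<^sub>Z m\<^sub>Z Z \<phi>\<^sub>Z,
      W_gauge_density \<xi>\<^sub>W m\<^sub>W W\<^sub>p W\<^sub>m \<phi>\<^sub>W\<^sub>p \<phi>\<^sub>W\<^sub>m,
      gauge_ghost_density gc f A c,
      electroweak_ghost_density J \<xi>\<^sub>c m\<^sub>c
        :: ('s, 'f, 'v, 'c, 'z::star_superalgebra) density}.
    finite_sum_of_interaction_terms R L"
  by (simp add: real_scalar_decomposable scalar_multiplet_decomposable spinor_decomposable
      spinor_multiplet_decomposable yukawa_decomposable yang_mills_decomposable
      lorenz_gauge_decomposable Z_gauge_decomposable W_gauge_decomposable gauge_ghost_decomposable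
      electroweak_ghost_decomposable)

end
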